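(* Let $M$ be a non-negative integer $(n\times n)$-matrix which is in PB-Frobenius form. Assume that none of the coordinate vectors $\vec e_1,\dots,\vec e_n$ is mapped by a positive power of $M$ to itself or to $\vec 0$. Then for any non-negative column vector $\vec v\neq\vec 0$ in $\mathbb{R}^n$ the limit $$\vec v_\infty=\lim_{t\to\infty}\frac{1}{\|M^t\vec v\|}M^t\vec v$$ exists, $\vec v_\infty\neq\vec 0$, and $\vec v_\infty$ is an eigenvector of $M$.
   Context: The norm on $\mathbb{R}^n$ is the $\ell_1$-norm $\|\sum a_i\vec e_i\|=\sum|a_i|$, where $\vec e_1,\dots,\vec e_n$ is the standard basis. A non-negative integer square matrix $N$ is called primitive if there is an exponent $k\ge 1$ such that all entries of $N^k$ are positive. It is called power bounded (PB) if the entries of $N^t$ are uniformly bounded for all $t\ge 1$. Assume $M$ is partitioned into matrix blocks such that the diagonal blocks are square matrices. $M$ is in PB-Frobenius form if (for such a partition) it is a lower triangular block matrix in which every diagonal block is either primitive or power bounded. A $(1\times 1)$ diagonal block with entry $0$ or $1$ is counted as a PB block and not as a primitive block. *)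

theory Defs
  imports
    Complex_Main
    "Jordan_Normal_Form.Char_Poly"
    "Jordan_Normal_Form.DL_Submatrix"
begin

definition nonneg_square_mat :: "int mat \<Rightarrow> bool" where
  "nonneg_square_mat N \<longleftrightarrow> square_mat N \<and> 0\<^sub>m (dim_row N) (dim_col N) \<le> N"

definition primitive_mat :: "int mat \<Rightarrow> bool" where
  "primitive_mat N \<longleftrightarrow> nonneg_square_mat N \<and>
     (\<exists>k\<ge>1. \<forall>i<dim_row N. \<forall>j<dim_col N. (N ^\<^sub>m k) $$ (i, j) > 0)"

definition power_bounded_mat :: "int mat \<Rightarrow> bool" where
  "power_bounded_mat N \<longleftrightarrow> nonneg_square_mat N \<and>
     (\<exists>C. \<forall>t\<ge>1. \<forall>i<dim_row N. \<forall>j<dim_col N. (N ^\<^sub>m t) $$ (i, j) \<le> C)"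

text \<open>By convention a \<open>(1 \<times> 1)\<close> diagonal block with entry 0 or 1 is a PB block and
  not a primitive block, although the matrix with single entry 1 satisfies \<open>primitive_mat\<close>.\<close>

definition primitive_block :: "int mat \<Rightarrow> bool" where
  "primitive_block N \<longleftrightarrow> primitive_mat N \<and>
     \<not> (dim_row N = 1 \<and> dim_col N = 1 \<and> N $$ (0, 0) \<in> {0, 1})"

definition PB_block :: "int mat \<Rightarrow> bool" where
  "PB_block N \<longleftrightarrow> power_bounded_mat N"

text \<open>A partition of the indices \<open>{0..<n}\<close> into consecutive non-empty intervals is given by
  the list \<open>ds\<close> of their lengths; \<open>block_indices ds p\<close> is the \<open>p\<close>-th interval and
  \<open>block ds M p q\<close> the block in block row \<open>p\<close> and block column \<open>q\<close>.\<close>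

definition block_partition :: "nat \<Rightarrow> nat list \<Rightarrow> bool" where
  "block_partition n ds \<longleftrightarrow> (\<forall>d\<in>set ds. d > 0) \<and> sum_list ds = n"

definition block_indices :: "nat list \<Rightarrow> nat \<Rightarrow> nat set" where
  "block_indices ds p = {sum_list (take p ds)..<sum_list (take (Suc p) ds)}"

definition block :: "nat list \<Rightarrow> 'a mat \<Rightarrow> nat \<Rightarrow> nat \<Rightarrow> 'a mat" where
  "block ds M p q = submatrix M (block_indices ds p) (block_indices ds q)"

definition PB_Frobenius_form :: "int mat \<Rightarrow> bool" where
  "PB_Frobenius_form M \<longleftrightarrow> square_mat M \<and>
     (\<exists>ds. block_partition (dim_row M) ds \<and>
        (\<forall>q<length ds. \<forall>p<q. block ds M p q = 0\<^sub>m (ds ! p) (ds ! q)) \<and>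
        (\<forall>p<length ds. primitive_block (block ds M p p) \<or> PB_block (block ds M p p)))"

definition l1_norm :: "real vec \<Rightarrow> real" where
  "l1_norm v = (\<Sum>i<dim_vec v. \<bar>v $ i\<bar>)"

text \<open>Convergence in \<open>\<real>\<^sup>n\<close> with respect to the \<open>\<ell>\<^sub>1\<close>-norm. The type of vectors of varying
  dimension carries no topology, and subtraction is only meaningful for vectors of equal
  dimension.\<close>

definition l1_tendsto :: "nat \<Rightarrow> (nat \<Rightarrow> real vec) \<Rightarrow> real vec \<Rightarrow> bool" where
  "l1_tendsto n x l \<longleftrightarrow> (\<forall>t. x t \<in> carrier_vec n) \<and> l \<in> carrier_vec n \<and>
     (\<lambda>t. l1_norm (x t - l)) \<longlonglongrightarrow> 0"

end

theory Submission
  imports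
    "HOL-Analysis.Uniform_Limit"
    "HOL-Real_Asymp.Real_Asymp"
    Defs
begin

text \<open>The proof follows the coordinates of the orbit \<open>M\<^sup>t v\<close> one diagonal block at a time and shows that
  each of them grows in a very restricted way: either more slowly than every \<open>r\<^sup>t\<close> with \<open>r > 1\<close>, or
  like \<open>c t\<^sup>k r\<^sup>t\<close> for some \<open>k\<close>, some \<open>r > 1\<close> and some \<open>c > 0\<close> (\<open>regular_growth\<close>). Two such sequences
  are always comparable, and this gives the limit directly. If the sum \<open>S\<close> of the coordinates is of the
  second kind, then each quotient of a coordinate by \<open>S\<close> converges. The limits sum to \<open>1\<close>, and since
  \<open>S (t + 1) / S t \<longlonglongrightarrow> r\<close>, the limit vector is an eigenvector for \<open>r\<close>.

  Why the coordinates grow regularly: in a lower triangular block matrix, the coordinates of one block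
  are driven by the block itself and by the coordinates of the earlier blocks, so that by variation of
  constants they are sums of convolutions of entries of powers of the block with regularly growing
  sequences (\<open>variation_of_constants\<close>). The entries of the powers of a power bounded block are bounded.
  For a primitive block they are asymptotic to \<open>c r\<^sup>t\<close>, by the Perron-Frobenius theorem for primitive
  matrices (\<open>perron_frobenius_limit\<close>). It remains to see that convolution preserves regular growth
  (\<open>regular_conv\<close>). If the two factors grow at different exponential rates, the faster one dominates and
  Tannery's theorem gives the limit. If both grow at the same rate \<open>r > 1\<close>, the polynomial degree goes up by one. Only
  non-negative sequences occur, so nothing cancels. The powers of a power bounded block may well be
  periodic, but they are subexponential, so that their period leaves no trace in the limit.

  Why \<open>S\<close> is not subexponential: suppose that a coordinate vector \<open>e\<^sub>i\<close> never reaches a primitive block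
  other than \<open>[1]\<close>. Among the coordinates reached by \<open>e\<^sub>i\<close>, those in the last block involved form a
  closed class on which the powers of \<open>M\<close> are bounded. No column vanishes, so the coordinate
  sum never decreases along an orbit in this class. Once it has reached its maximum, every
  coordinate vector in the support is sent to single coordinate vectors for ever, and by the pigeonhole
  principle one of them is periodic (\<open>bounded_class_periodic\<close>), against the hypothesis. Hence every
  \<open>e\<^sub>i\<close> reaches a primitive block in which some diagonal entry of a power is at least \<open>2\<close>, which makes
  its orbit grow exponentially.\<close>

section \<open>Products of a polynomial and an exponential\<close>

text \<open>The binomial coefficient is asymptotic to \<open>t\<^sup>k / k!\<close>. It is a better choice than \<open>t\<^sup>k\<close> because
  it never vanishes, is monotone in \<open>t\<close>, and turns the convolution with \<open>r\<^sup>t\<close> into an exact identity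
  (\<open>conv_polyexp\<close>).\<close>
definition polyexp :: "nat \<Rightarrow> real \<Rightarrow> nat \<Rightarrow> real" where
  "polyexp k r t = real ((t + k) choose k) * r ^ t"

definition conv :: "(nat \<Rightarrow> real) \<Rightarrow> (nat \<Rightarrow> real) \<Rightarrow> nat \<Rightarrow> real" where
  "conv f g t = (\<Sum>s\<le>t. f s * g (t - s))"

lemma polyexp_0: "polyexp 0 r t = r ^ t"
  by (simp add: polyexp_def)

lemma polyexp_pos: "0 < r \<Longrightarrow> 0 < polyexp k r t"
  by (simp add: polyexp_def)

lemma polyexp_Suc: "polyexp (Suc k) r t = polyexp k r t * (real t + real k + 1) / (real k + 1)"
proof -
  have "real (Suc k * (Suc (t + k) choose Suc k)) = real (Suc (t + k) * ((t + k) choose k))"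
    by (simp only: Suc_times_binomial)
  hence "(real k + 1) * real ((t + Suc k) choose Suc k) = (real t + real k + 1) * real ((t + k) choose k)"
    by (simp add: algebra_simps)
  thus ?thesis
    by (simp add: polyexp_def field_simps)
qed

text \<open>This is the hockey-stick identity for binomial coefficients.\<close>
lemma conv_polyexp: "conv (polyexp 0 r) (polyexp k r) t = polyexp (Suc k) r t"
proof -
  have "conv (polyexp 0 r) (polyexp k r) t = (\<Sum>s\<le>t. real ((t - s + k) choose k) * r ^ t)"
    unfolding conv_def polyexp_def
    by (intro sum.cong) (auto simp: mult.assoc mult.left_commute simp flip: power_add)
  also have "\<dots> = r ^ t * real (\<Sum>s\<le>t. ((t - s + k) choose k))"
    by (simp add: sum_distrib_left mult.commute)
  also have "(\<Sum>s\<le>t. ((t - s + k) choose k)) = (\<Sum>s\<le>t. ((s + k) choose k))"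
    by (rule sum.reindex_bij_witness[of _ "\<lambda>s. t - s" "\<lambda>s. t - s"]) auto
  also have "\<dots> = (\<Sum>s\<le>t. ((k + s) choose s))"
    by (intro sum.cong refl) (metis add.commute add_diff_cancel_right' binomial_symmetric le_add2)
  also have "\<dots> = Suc (k + t) choose t"
    by (rule sum_choose_lower)
  also have "\<dots> = (t + Suc k) choose Suc k"
    by (metis add.commute add_Suc_right add_diff_cancel_left' binomial_symmetric le_add1)
  finally show ?thesis
    unfolding polyexp_def by (simp only: mult.commute)
qed

lemma conv_commute: "conv f g t = conv g f t"
  unfolding conv_def
  by (rule sum.reindex_bij_witness[of _ "\<lambda>s. t - s" "\<lambda>s. t - s"]) auto

lemma conv_nonneg: "(\<And>t. 0 \<le> f t) \<Longrightarrow> (\<And>t. 0 \<le> g t) \<Longrightarrow> 0 \<le> conv f g t"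
  by (simp add: conv_def sum_nonneg)

lemma polyexp_Suc_ratio:
  assumes "0 < r"
  shows "(\<lambda>t. polyexp k r (Suc t) / polyexp k r t) \<longlonglongrightarrow> r"
proof -
  have "polyexp k r (Suc t) / polyexp k r t = r * ((real t + real k + 1) / (real t + 1))" for t
  proof -
    have "(Suc t + k - k) * (Suc t + k choose k) = (Suc t + k) * ((Suc t + k - 1) choose k)"
      by (rule binomial_absorb_comp)
    hence "real ((Suc t) * (Suc t + k choose k)) = real ((Suc t + k) * ((t + k) choose k))"
      by simp
    hence "(real t + 1) * real (Suc t + k choose k) = (real t + real k + 1) * real ((t + k) choose k)"
      by (simp add: algebra_simps)
    hence "real (Suc t + k choose k) = (real t + real k + 1) / (real t + 1) * real ((t + k) choose k)"
      by (simp add: field_simps)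
    thus ?thesis
      using assms by (simp add: polyexp_def)
  qed
  moreover have "(\<lambda>t. r * ((real t + real k + 1) / (real t + 1))) \<longlonglongrightarrow> r"
    by real_asymp
  ultimately show ?thesis by simp
qed

lemma polyexp_shift_ratio:
  assumes "0 < r"
  shows "(\<lambda>t. polyexp k r t / polyexp k r (t + s)) \<longlonglongrightarrow> inverse r ^ s"
proof (induction s)
  case 0
  have "polyexp k r t / polyexp k r t = 1" for t
    using polyexp_pos[OF assms, of k t] by simp
  thus ?case by simp
next
  case (Suc s)
  have "(\<lambda>t. inverse (polyexp k r (Suc (t + s)) / polyexp k r (t + s))) \<longlonglongrightarrow> inverse r"
    using assms LIMSEQ_ignore_initial_segment[OF polyexp_Suc_ratio[OF assms, of k], of s]
    by (intro tendsto_inverse) auto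
  from tendsto_mult[OF this Suc]
  have "(\<lambda>t. inverse (polyexp k r (Suc (t + s)) / polyexp k r (t + s)) * (polyexp k r t / polyexp k r (t + s)))
     \<longlonglongrightarrow> inverse r ^ Suc s" by simp
  moreover have "inverse (polyexp k r (Suc (t + s)) / polyexp k r (t + s)) * (polyexp k r t / polyexp k r (t + s))
     = polyexp k r t / polyexp k r (t + Suc s)" for t
    using polyexp_pos[OF assms, of k "t + s"] by (simp add: field_simps)
  ultimately show ?case by simp
qed

lemma polyexp_diff_le:
  assumes "0 < r" "s \<le> t"
  shows "polyexp k r (t - s) \<le> polyexp k r t * inverse r ^ s"
proof -
  have "(t - s + k) choose k \<le> (t + k) choose k"
    by (rule binomial_right_mono) simp
  hence "real ((t - s + k) choose k) * r ^ (t - s) \<le> real ((t + k) choose k) * r ^ (t - s)"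
    using assms by (intro mult_right_mono) simp_all
  moreover have "r ^ (t - s) = r ^ t * inverse r ^ s"
    using assms by (simp add: power_diff divide_inverse power_inverse)
  ultimately show ?thesis
    unfolding polyexp_def by (simp only: mult.assoc)
qed

lemma polyexp_ratio_eq: "polyexp k r t / polyexp 0 q t = polyexp k (r / q) t"
  by (simp add: polyexp_def power_divide)

text \<open>A Cauchy product with a geometric series raises \<open>k\<close> by one.\<close>
lemma summable_polyexp:
  assumes "0 < r" "r < 1"
  shows "summable (polyexp k r)"
proof (induction k)
  case 0
  show ?case using assms by (simp add: polyexp_0[abs_def] summable_geometric)
next
  case (Suc k)
  have "summable (\<lambda>t. conv (polyexp 0 r) (polyexp k r) t)"
    unfolding conv_def
    using assms Suc by (intro summable_Cauchy_product)
      (simp_all add: polyexp_0[abs_def] summable_geometric less_imp_le[OF polyexp_pos])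
  thus ?case by (simp add: conv_polyexp)
qed

lemma polyexp_less_rate:
  assumes "0 < r" "r < q"
  shows "(\<lambda>t. polyexp k r t / polyexp l q t) \<longlonglongrightarrow> 0"
proof (rule tendsto_sandwich)
  show "\<forall>\<^sub>F t in sequentially. 0 \<le> polyexp k r t / polyexp l q t"
    using assms by (auto intro!: always_eventually divide_nonneg_nonneg less_imp_le[OF polyexp_pos])
  show "\<forall>\<^sub>F t in sequentially. polyexp k r t / polyexp l q t \<le> polyexp k (r / q) t"
  proof (intro always_eventually allI)
    fix t
    have "1 \<le> (t + l) choose l"
      by (simp add: Suc_le_eq)
    from of_nat_mono[OF this] have "1 \<le> real ((t + l) choose l)"
      by simp
    hence "polyexp 0 q t \<le> polyexp l q t"
      unfolding polyexp_def using assms by (intro mult_right_mono) simp_all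
    hence "polyexp k r t / polyexp l q t \<le> polyexp k r t / polyexp 0 q t"
      using assms by (intro divide_left_mono mult_pos_pos polyexp_pos less_imp_le[OF polyexp_pos]) auto
    thus "polyexp k r t / polyexp l q t \<le> polyexp k (r / q) t"
      by (simp add: polyexp_ratio_eq)
  qed
  have "r / q < 1" "0 < r / q" using assms by auto
  thus "polyexp k (r / q) \<longlonglongrightarrow> 0"
    by (intro summable_LIMSEQ_zero summable_polyexp)
qed simp

lemma polyexp_less_degree_Suc:
  assumes "0 < r"
  shows "(\<lambda>t. polyexp k r t / polyexp (Suc k) r t) \<longlonglongrightarrow> 0"
proof -
  have "polyexp k r t / polyexp (Suc k) r t = (real k + 1) / (real t + real k + 1)" for t
    using polyexp_pos[OF assms, of k t] by (simp add: polyexp_Suc)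
  moreover have "(\<lambda>t. (real k + 1) / (real t + real k + 1)) \<longlonglongrightarrow> 0"
    by real_asymp
  ultimately show ?thesis by simp
qed

text \<open>The comparison step used throughout: anything comparable to \<open>g\<close> is negligible against whatever
  dominates \<open>g\<close>.\<close>
lemma ratio_tendsto_0_trans:
  fixes f g h :: "nat \<Rightarrow> real"
  assumes "(\<lambda>t. f t / g t) \<longlonglongrightarrow> c" "(\<lambda>t. g t / h t) \<longlonglongrightarrow> 0" "\<And>t. g t \<noteq> 0"
  shows "(\<lambda>t. f t / h t) \<longlonglongrightarrow> 0"
  using tendsto_mult[OF assms(1,2)] assms(3) by simp

lemma polyexp_less_degree:
  assumes "0 < r" "k < l"
  shows "(\<lambda>t. polyexp k r t / polyexp l r t) \<longlonglongrightarrow> 0"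
  using assms(2)
proof (induction l)
  case (Suc l)
  show ?case
  proof (cases "k = l")
    case True
    thus ?thesis using polyexp_less_degree_Suc[OF assms(1)] by simp
  next
    case False
    with Suc have "(\<lambda>t. polyexp k r t / polyexp l r t) \<longlonglongrightarrow> 0"
      by (simp add: less_Suc_eq)
    thus ?thesis
      by (rule ratio_tendsto_0_trans[OF _ polyexp_less_degree_Suc[OF assms(1)]])
         (use polyexp_pos[OF assms(1), of l] in \<open>simp add: less_imp_neq[symmetric]\<close>)
  qed
qed simp

section \<open>Sequences of regular growth\<close>

lemma polyexp_trichotomy:
  assumes "0 < r" "0 < q"
  obtains "k = l" "r = q"
  | "(\<lambda>t. polyexp k r t / polyexp l q t) \<longlonglongrightarrow> 0"
  | "(\<lambda>t. polyexp l q t / polyexp k r t) \<longlonglongrightarrow> 0"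
proof -
  consider "r < q" | "q < r" | "r = q" "k < l" | "r = q" "l < k" | "r = q" "k = l"
    by linarith
  thus ?thesis
  proof cases
    case 1
    thus ?thesis using that(2) polyexp_less_rate assms by blast
  next
    case 2
    thus ?thesis using that(3) polyexp_less_rate assms by blast
  next
    case 3
    thus ?thesis using that(2) polyexp_less_degree[OF assms(1) 3(2)] by simp
  next
    case 4
    thus ?thesis using that(3) polyexp_less_degree[OF assms(1) 4(2)] by simp
  next
    case 5
    thus ?thesis using that(1) by simp
  qed
qed

text \<open>Here \<open>polyexp 0 r t\<close> is just \<open>r ^ t\<close>; this form lets the comparison lemmas for \<open>polyexp\<close> apply
  without rewriting.\<close>
definition subexponential :: "(nat \<Rightarrow> real) \<Rightarrow> bool" where
  "subexponential f \<longleftrightarrow> (\<forall>r>1. (\<lambda>t. f t / polyexp 0 r t) \<longlonglongrightarrow> 0)"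

definition grows_like :: "(nat \<Rightarrow> real) \<Rightarrow> nat \<Rightarrow> real \<Rightarrow> bool" where
  "grows_like f k r \<longleftrightarrow> 1 < r \<and> (\<exists>c>0. (\<lambda>t. f t / polyexp k r t) \<longlonglongrightarrow> c)"

lemma grows_likeI:
  "1 < r \<Longrightarrow> 0 < c \<Longrightarrow> (\<lambda>t. f t / polyexp k r t) \<longlonglongrightarrow> c \<Longrightarrow> grows_like f k r"
  by (auto simp: grows_like_def)

definition regular_growth :: "(nat \<Rightarrow> real) \<Rightarrow> bool" where
  "regular_growth f \<longleftrightarrow> (\<forall>t. 0 \<le> f t) \<and> (subexponential f \<or> (\<exists>k r. grows_like f k r))"

lemma subexponential_ratio:
  assumes "subexponential f" "1 < q"
  shows "(\<lambda>t. f t / polyexp l q t) \<longlonglongrightarrow> 0"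
proof -
  obtain r where r: "1 < r" "r < q" using dense assms(2) by blast
  have "(\<lambda>t. f t / polyexp 0 r t) \<longlonglongrightarrow> 0"
    using assms(1) r by (simp add: subexponential_def)
  thus ?thesis
  proof (rule ratio_tendsto_0_trans)
    show "(\<lambda>t. polyexp 0 r t / polyexp l q t) \<longlonglongrightarrow> 0"
      using r by (intro polyexp_less_rate) auto
  qed (use r in \<open>simp add: polyexp_0\<close>)
qed

text \<open>A regularly growing sequence has a finite limit relative to each fixed scale, or it is itself comparable to
  a scale that dominates the given one. This replaces case distinctions on the pairs of rate
  and degree in what follows.\<close>
lemma regular_compare:
  assumes "regular_growth f" "1 < q"
  obtains c where "0 \<le> c" "(\<lambda>t. f t / polyexp l q t) \<longlonglongrightarrow> c"
  | k r c where "1 < r" "0 < c" "(\<lambda>t. f t / polyexp k r t) \<longlonglongrightarrow> c"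
      "(\<lambda>t. polyexp l q t / polyexp k r t) \<longlonglongrightarrow> 0"
proof (cases "subexponential f")
  case True
  thus ?thesis using subexponential_ratio[OF True assms(2)] that(1)[of 0] by simp
next
  case False
  then obtain k r c where f: "1 < r" "0 < c" "(\<lambda>t. f t / polyexp k r t) \<longlonglongrightarrow> c"
    using assms(1) by (auto simp: regular_growth_def grows_like_def)
  from f(1) assms(2) have "0 < r" "0 < q" by auto
  thus ?thesis
  proof (cases rule: polyexp_trichotomy[of r q k l])
    case 1
    thus ?thesis using that(1)[of c] f by simp
  next
    case 2
    from \<open>0 < r\<close> have "polyexp k r t \<noteq> 0" for t
      using polyexp_pos[of r k t] by simp
    thus ?thesis using that(1)[of 0] ratio_tendsto_0_trans[OF f(3) 2] by simp
  next
    case 3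
    thus ?thesis using that(2) f by blast
  qed
qed

lemma regular_nonneg: "regular_growth f \<Longrightarrow> 0 \<le> f t"
  by (simp add: regular_growth_def)

lemma subexponential_add:
  "subexponential f \<Longrightarrow> subexponential g \<Longrightarrow> subexponential (\<lambda>t. f t + g t)"
  unfolding subexponential_def add_divide_distrib
  by (auto intro: tendsto_add_zero)

text \<open>Non-negativity matters here: the limits of the two summands relative to the larger scale cannot
  cancel, so that the sum keeps a positive limit.\<close>
lemma regular_add_grows_like:
  assumes f: "regular_growth f" and g: "regular_growth g" "grows_like g l q"
  shows "regular_growth (\<lambda>t. f t + g t)"
proof -
  from g(2) obtain d where d: "1 < q" "0 < d" "(\<lambda>t. g t / polyexp l q t) \<longlonglongrightarrow> d"
    by (auto simp: grows_like_def)
  have "\<exists>k r. grows_like (\<lambda>t. f t + g t) k r"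
  proof (cases rule: regular_compare[OF f d(1), of l])
    case (1 c)
    hence "(\<lambda>t. (f t + g t) / polyexp l q t) \<longlonglongrightarrow> c + d" "0 < c + d"
      unfolding add_divide_distrib using d by (auto intro: tendsto_add)
    thus ?thesis using d(1) by (auto simp: grows_like_def)
  next
    case (2 k r c)
    from d(1) have "polyexp l q t \<noteq> 0" for t
      using polyexp_pos[of q l t] by simp
    hence "(\<lambda>t. g t / polyexp k r t) \<longlonglongrightarrow> 0"
      using ratio_tendsto_0_trans[OF d(3) 2(4)] by simp
    hence "(\<lambda>t. (f t + g t) / polyexp k r t) \<longlonglongrightarrow> c + 0"
      unfolding add_divide_distrib using 2 by (intro tendsto_add)
    thus ?thesis using 2(1,2) by (auto simp: grows_like_def)
  qed
  thus ?thesis using f g by (simp add: regular_growth_def)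
qed

lemma regular_add:
  assumes "regular_growth f" "regular_growth g"
  shows "regular_growth (\<lambda>t. f t + g t)"
proof (cases "subexponential f \<and> subexponential g")
  case True
  thus ?thesis using assms by (simp add: regular_growth_def subexponential_add)
next
  case False
  then obtain k r where "grows_like f k r \<or> grows_like g k r"
    using assms by (auto simp: regular_growth_def)
  thus ?thesis
    using regular_add_grows_like[OF assms, of k r] regular_add_grows_like[OF assms(2,1), of k r]
    by (auto simp: add.commute)
qed

lemma subexponential_zero: "subexponential (\<lambda>t. 0)"
  by (simp add: subexponential_def)

lemma regular_zero: "regular_growth (\<lambda>t. 0)"
  by (simp add: regular_growth_def subexponential_zero)

lemma regular_sum: "(\<And>i. i \<in> I \<Longrightarrow> regular_growth (f i)) \<Longrightarrow> regular_growth (\<lambda>t. \<Sum>i\<in>I. f i t)"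
  by (induction I rule: infinite_finite_induct) (auto simp: regular_zero regular_add)

lemma regular_cmult:
  assumes "regular_growth f" "0 \<le> a"
  shows "regular_growth (\<lambda>t. a * f t)"
proof (cases "a = 0")
  case True
  thus ?thesis by (simp add: regular_zero)
next
  case False
  with assms have a: "0 < a" by simp
  have lim: "(\<lambda>t. a * f t / polyexp k r t) \<longlonglongrightarrow> a * c" if "(\<lambda>t. f t / polyexp k r t) \<longlonglongrightarrow> c" for k r c
    using tendsto_mult_left[OF that, of a] by simp
  have "subexponential (\<lambda>t. a * f t)" if "subexponential f"
    using lim[of 0 _ 0] that by (simp add: subexponential_def)
  moreover have "grows_like (\<lambda>t. a * f t) k r" if "grows_like f k r" for k r
    using that lim[of k r] a unfolding grows_like_def by (metis mult_pos_pos)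
  moreover have "\<forall>t. 0 \<le> a * f t"
    using assms regular_nonneg by simp
  ultimately show ?thesis
    using assms(1) unfolding regular_growth_def by blast
qed

lemma ratio_unshift:
  assumes "0 < r" "(\<lambda>t. f (Suc t) / polyexp k r t) \<longlonglongrightarrow> c"
  shows "(\<lambda>t. f t / polyexp k r t) \<longlonglongrightarrow> c / r"
proof (rule LIMSEQ_imp_Suc)
  have lim: "(\<lambda>t. f (Suc t) / polyexp k r t / (polyexp k r (Suc t) / polyexp k r t)) \<longlonglongrightarrow> c / r"
    using assms by (intro tendsto_divide polyexp_Suc_ratio) auto
  have "f (Suc t) / polyexp k r t / (polyexp k r (Suc t) / polyexp k r t)
      = f (Suc t) / polyexp k r (Suc t)" for t
    using polyexp_pos[OF assms(1), of k t] by simp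
  with lim show "(\<lambda>t. f (Suc t) / polyexp k r (Suc t)) \<longlonglongrightarrow> c / r"
    by (simp only:)
qed

lemma regular_unshift:
  assumes "0 \<le> f 0" "regular_growth (\<lambda>t. f (Suc t))"
  shows "regular_growth f"
proof -
  have "0 \<le> f t" for t
    using assms regular_nonneg[OF assms(2)] by (cases t) auto
  moreover have "subexponential f" if "subexponential (\<lambda>t. f (Suc t))"
    using that ratio_unshift[of _ f 0 0] by (simp add: subexponential_def)
  moreover have "grows_like f k r" if "grows_like (\<lambda>t. f (Suc t)) k r" for k r
  proof -
    from that obtain c where "1 < r" "0 < c" "(\<lambda>t. f (Suc t) / polyexp k r t) \<longlonglongrightarrow> c"
      by (auto simp: grows_like_def)
    moreover from this have "0 < c / r" by simp
    ultimately show ?thesis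
      unfolding grows_like_def
      by (intro conjI exI[of _ "c / r"] ratio_unshift) auto
  qed
  ultimately show ?thesis
    using assms(2) unfolding regular_growth_def by blast
qed

lemma bounded_ratio:
  assumes "(\<lambda>t. f t / polyexp k r t) \<longlonglongrightarrow> c" "0 < r"
  obtains K where "0 \<le> K" "\<And>t. \<bar>f t\<bar> \<le> K * polyexp k r t"
proof -
  have "Bseq (\<lambda>t. f t / polyexp k r t)"
    using assms(1) by (intro convergent_imp_Bseq convergentI)
  then obtain K where K: "0 < K" "\<And>t. norm (f t / polyexp k r t) \<le> K"
    unfolding Bseq_def by blast
  have "\<bar>f t\<bar> \<le> K * polyexp k r t" for t
  proof -
    have "\<bar>f t\<bar> / polyexp k r t \<le> K"
      using K(2)[of t] polyexp_pos[OF assms(2), of k t] by simp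
    thus ?thesis
      by (simp only: pos_divide_le_eq[OF polyexp_pos[OF assms(2)]])
  qed
  thus thesis
    using K(1) by (intro that[of K]) auto
qed

lemma summable_smaller_rate:
  assumes "(\<lambda>t. f t / polyexp k r t) \<longlonglongrightarrow> c" "0 < r" "r < q"
  shows "summable (\<lambda>s. f s * inverse q ^ s)"
proof -
  obtain K where K: "0 \<le> K" "\<And>t. \<bar>f t\<bar> \<le> K * polyexp k r t"
    using bounded_ratio assms by blast
  have q: "0 < q" using assms by simp
  show ?thesis
  proof (rule summable_comparison_test)
    show "summable (\<lambda>t. K * polyexp k (r / q) t)"
      using assms by (intro summable_mult summable_polyexp) auto
    have "norm (f t * inverse q ^ t) \<le> K * polyexp k (r / q) t" for t
    proof -
      have "norm (f t * inverse q ^ t) = \<bar>f t\<bar> * inverse q ^ t"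
        using q by (simp add: abs_mult)
      also have "\<dots> \<le> K * polyexp k r t * inverse q ^ t"
        using q K by (intro mult_right_mono) auto
      also have "\<dots> = K * polyexp k (r / q) t"
        by (simp add: polyexp_def power_divide divide_inverse power_inverse power_mult_distrib)
      finally show ?thesis .
    qed
    thus "\<exists>N. \<forall>n\<ge>N. norm (f n * inverse q ^ n) \<le> K * polyexp k (r / q) n" by blast
  qed
qed

text \<open>When \<open>f\<close> is of smaller exponential rate than \<open>g\<close>, the bulk of the convolution comes from small
  \<open>s\<close>, where \<open>g (t - s)\<close> is about \<open>q\<^sup>-\<^sup>s g t\<close>. The monotonicity of the binomial coefficients
  (\<open>polyexp_diff_le\<close>) provides the dominating series for Tannery's theorem.\<close>
lemma conv_summable_limit:
  assumes f: "\<And>s. 0 \<le> f s" "summable (\<lambda>s. f s * inverse q ^ s)"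
    and g: "(\<lambda>t. g t / polyexp k q t) \<longlonglongrightarrow> c" and q: "0 < q"
  shows "(\<lambda>t. conv f g t / polyexp k q t) \<longlonglongrightarrow> (\<Sum>s. f s * inverse q ^ s) * c"
proof -
  obtain K where K: "0 \<le> K" "\<And>t. \<bar>g t\<bar> \<le> K * polyexp k q t"
    using bounded_ratio g q by blast
  note pos = polyexp_pos[OF q]
  \<comment> \<open>Extended by \<open>0\<close> beyond \<open>t\<close>, since Tannery's theorem is about series.\<close>
  define a where "a s t = (if s \<le> t then f s * g (t - s) / polyexp k q t else 0)" for s t
  have "(\<lambda>t. a s t) \<longlonglongrightarrow> f s * inverse q ^ s * c" for s
  proof (rule LIMSEQ_offset[of _ s])
    have "(\<lambda>t. f s * (g t / polyexp k q t) * (polyexp k q t / polyexp k q (t + s))) \<longlonglongrightarrow> f s * c * inverse q ^ s"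
      by (intro tendsto_mult tendsto_const g polyexp_shift_ratio q)
    moreover have "f s * (g t / polyexp k q t) * (polyexp k q t / polyexp k q (t + s)) = a s (t + s)" for t
      using pos[of k t] by (simp add: a_def)
    ultimately show "(\<lambda>t. a s (t + s)) \<longlonglongrightarrow> f s * inverse q ^ s * c"
      by (simp add: mult_ac)
  qed
  moreover have "norm (a s t) \<le> K * (f s * inverse q ^ s)" for s t
  proof (cases "s \<le> t")
    case True
    have "f s * \<bar>g (t - s)\<bar> \<le> f s * (K * (polyexp k q t * inverse q ^ s))"
      using K polyexp_diff_le[OF q True, of k]
      by (intro mult_left_mono order_trans[OF K(2)] f) auto
    thus ?thesis using True pos[of k t] f(1)[of s]
      by (simp add: a_def abs_mult field_simps)
  next
    case False
    thus ?thesis using K f q by (simp add: a_def)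
  qed
  hence "\<forall>\<^sub>F (s, t) in at_top \<times>\<^sub>F sequentially. norm (a s t) \<le> K * (f s * inverse q ^ s)"
    by (auto intro: always_eventually)
  ultimately have "(\<lambda>t. \<Sum>s. a s t) \<longlonglongrightarrow> (\<Sum>s. f s * inverse q ^ s * c)"
    using tannerys_theorem[of a "\<lambda>s. f s * inverse q ^ s * c" sequentially "\<lambda>s. K * (f s * inverse q ^ s)"]
      summable_mult[OF f(2), of K] by simp
  moreover have "(\<Sum>s. a s t) = conv f g t / polyexp k q t" for t
  proof -
    have "(\<Sum>s. a s t) = (\<Sum>s\<le>t. a s t)"
      by (rule suminf_finite) (auto simp: a_def)
    also have "\<dots> = conv f g t / polyexp k q t"
      by (simp add: a_def conv_def sum_divide_distrib)
    finally show ?thesis .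
  qed
  ultimately show ?thesis
    by (simp add: suminf_mult2[OF f(2)])
qed

text \<open>The Toeplitz argument: the weights move off every fixed index, so that only the small tail of \<open>y\<close>
  counts.\<close>
lemma weighted_average_tendsto_0:
  fixes w :: "nat \<Rightarrow> nat \<Rightarrow> real"
  assumes w: "\<And>s t. s \<le> t \<Longrightarrow> 0 \<le> w t s" "\<And>t. (\<Sum>s\<le>t. w t s) \<le> 1" "\<And>s. (\<lambda>t. w t s) \<longlonglongrightarrow> 0"
    and y: "y \<longlonglongrightarrow> 0"
  shows "(\<lambda>t. \<Sum>s\<le>t. w t s * \<bar>y s\<bar>) \<longlonglongrightarrow> 0"
proof (rule LIMSEQ_I)
  fix e :: real assume e: "0 < e"
  obtain N where N: "\<And>s. s \<ge> N \<Longrightarrow> \<bar>y s\<bar> < e / 2"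
    using LIMSEQ_D[OF y, of "e / 2"] e by auto
  have "(\<lambda>t. \<Sum>s<N. w t s * \<bar>y s\<bar>) \<longlonglongrightarrow> (\<Sum>s<N. 0 * \<bar>y s\<bar>)"
    by (intro tendsto_sum tendsto_mult tendsto_const w)
  hence "\<forall>\<^sub>F t in sequentially. (\<Sum>s<N. w t s * \<bar>y s\<bar>) < e / 2"
    using e by (intro order_tendstoD) auto
  then obtain T where T: "\<And>t. t \<ge> T \<Longrightarrow> (\<Sum>s<N. w t s * \<bar>y s\<bar>) < e / 2"
    by (auto simp: eventually_sequentially)
  have "norm ((\<Sum>s\<le>t. w t s * \<bar>y s\<bar>) - 0) < e" if t: "t \<ge> max T N" for t
  proof -
    have "(\<Sum>s\<le>t. w t s * \<bar>y s\<bar>) = (\<Sum>s<N. w t s * \<bar>y s\<bar>) + (\<Sum>s\<in>{N..t}. w t s * \<bar>y s\<bar>)"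
      using t by (subst sum.union_disjoint[symmetric]) (auto intro!: sum.cong)
    also have "(\<Sum>s\<in>{N..t}. w t s * \<bar>y s\<bar>) \<le> (\<Sum>s\<in>{N..t}. w t s * (e / 2))"
      using N w(1) by (intro sum_mono mult_left_mono) (auto intro: less_imp_le)
    also have "\<dots> \<le> (\<Sum>s\<le>t. w t s * (e / 2))"
      using e w(1) by (intro sum_mono2) auto
    also have "\<dots> = (\<Sum>s\<le>t. w t s) * (e / 2)"
      by (simp only: sum_distrib_right)
    also have "\<dots> \<le> 1 * (e / 2)"
      using e w(2)[of t] by (intro mult_right_mono) auto
    finally have "(\<Sum>s\<le>t. w t s * \<bar>y s\<bar>) < e"
      using T[of t] t by simp
    moreover have "0 \<le> (\<Sum>s\<le>t. w t s * \<bar>y s\<bar>)"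
      using w(1) by (intro sum_nonneg) auto
    ultimately show ?thesis by simp
  qed
  thus "\<exists>T. \<forall>t\<ge>T. norm ((\<Sum>s\<le>t. w t s * \<bar>y s\<bar>) - 0) < e" by blast
qed

lemma polyexp_shifted_less_degree:
  assumes "0 < r" "k < l"
  shows "(\<lambda>t. polyexp k r (t - s) / polyexp l r t) \<longlonglongrightarrow> 0"
proof (rule LIMSEQ_offset[of _ s])
  have lim: "(\<lambda>t. polyexp k r t / polyexp l r t * (polyexp l r t / polyexp l r (t + s))) \<longlonglongrightarrow> 0 * inverse r ^ s"
    by (intro tendsto_mult polyexp_less_degree polyexp_shift_ratio assms)
  have "polyexp k r t / polyexp l r t * (polyexp l r t / polyexp l r (t + s)) = polyexp k r t / polyexp l r (t + s)" for t
    using polyexp_pos[OF assms(1), of l t] by simp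
  with lim show "(\<lambda>t. polyexp k r (t + s - s) / polyexp l r (t + s)) \<longlonglongrightarrow> 0"
    by (simp only: mult_zero_left add_diff_cancel_right')
qed

text \<open>With equal exponential rates no single part of the convolution dominates. Dividing it by the
  convolution of the two scales, which is exactly \<open>polyexp (Suc k) r\<close>, turns it into a weighted average
  of the products of \<open>f s / r\<^sup>s\<close> and \<open>g (t - s) / polyexp k r (t - s)\<close>. Both factors converge, and the
  weight near either end of the summation range is negligible.\<close>
lemma conv_same_rate_limit:
  assumes f: "(\<lambda>t. f t / polyexp 0 r t) \<longlonglongrightarrow> a" and g: "(\<lambda>t. g t / polyexp k r t) \<longlonglongrightarrow> b"
    and r: "0 < r"
  shows "(\<lambda>t. conv f g t / polyexp (Suc k) r t) \<longlonglongrightarrow> a * b"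
proof -
  note pos = polyexp_pos[OF r]
  define F where "F t = f t / polyexp 0 r t" for t
  define G where "G t = g t / polyexp k r t" for t
  define w where "w t s = polyexp 0 r s * polyexp k r (t - s) / polyexp (Suc k) r t" for t s
  define w' where "w' t s = polyexp 0 r (t - s) * polyexp k r s / polyexp (Suc k) r t" for t s
  have w_nonneg: "0 \<le> w t s" "0 \<le> w' t s" for t s
    using pos by (simp_all add: w_def w'_def less_imp_le)
  have w_sum: "(\<Sum>s\<le>t. w t s) = 1" for t
    using conv_polyexp[of r k t] pos[of "Suc k" t] by (simp add: w_def conv_def flip: sum_divide_distrib)
  have reindex: "(\<Sum>s\<le>t. w t s * h (t - s)) = (\<Sum>s\<le>t. w' t s * h s)" for t and h :: "nat \<Rightarrow> real"
    by (rule sum.reindex_bij_witness[of _ "\<lambda>s. t - s" "\<lambda>s. t - s"]) (auto simp: w_def w'_def)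
  have w'_sum: "(\<Sum>s\<le>t. w' t s) = 1" for t
    using reindex[of t "\<lambda>_. 1"] w_sum[of t] by simp
  have w_lim: "(\<lambda>t. w t s) \<longlonglongrightarrow> 0" for s
    using tendsto_mult_left[OF polyexp_shifted_less_degree[OF r, of k "Suc k" s], of "polyexp 0 r s"]
    by (simp add: w_def)
  have w'_lim: "(\<lambda>t. w' t s) \<longlonglongrightarrow> 0" for s
    using tendsto_mult_left[OF polyexp_shifted_less_degree[OF r, of 0 "Suc k" s], of "polyexp k r s"]
    by (simp add: w'_def mult.commute)
  have Fa: "(\<lambda>t. F t - a) \<longlonglongrightarrow> 0" and Gb: "(\<lambda>t. G t - b) \<longlonglongrightarrow> 0"
    using f g by (simp_all add: F_def G_def LIM_zero)
  have "Bseq G"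
    using g unfolding G_def by (intro convergent_imp_Bseq convergentI)
  then obtain K where K: "0 < K" "\<And>t. norm (G t) \<le> K"
    unfolding Bseq_def by blast
  have split: "u * (x * y) - u * (a * b) = u * (y * (x - a) + a * (y - b))" for u x y :: real
    by (simp add: algebra_simps)
  have "(\<lambda>t. conv f g t / polyexp (Suc k) r t - a * b) \<longlonglongrightarrow> 0"
  proof (rule Lim_null_comparison)
    show "(\<lambda>t. K * (\<Sum>s\<le>t. w t s * \<bar>F s - a\<bar>) + \<bar>a\<bar> * (\<Sum>s\<le>t. w' t s * \<bar>G s - b\<bar>)) \<longlonglongrightarrow> 0"
      by (intro tendsto_add_zero tendsto_mult_right_zero weighted_average_tendsto_0 Fa Gb w_lim w'_lim)
         (auto simp: w_nonneg w_sum w'_sum)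
    show "\<forall>\<^sub>F t in sequentially. norm (conv f g t / polyexp (Suc k) r t - a * b)
        \<le> K * (\<Sum>s\<le>t. w t s * \<bar>F s - a\<bar>) + \<bar>a\<bar> * (\<Sum>s\<le>t. w' t s * \<bar>G s - b\<bar>)"
    proof (intro always_eventually allI)
      fix t
      have "f s * g (t - s) / polyexp (Suc k) r t = w t s * (F s * G (t - s))" for s
        using pos[of 0 s] pos[of k "t - s"] by (simp add: w_def F_def G_def)
      hence "conv f g t / polyexp (Suc k) r t = (\<Sum>s\<le>t. w t s * (F s * G (t - s)))"
        by (simp add: conv_def sum_divide_distrib)
      moreover have "a * b = (\<Sum>s\<le>t. w t s * (a * b))"
        by (simp add: w_sum flip: sum_distrib_right)
      ultimately have "conv f g t / polyexp (Suc k) r t - a * b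
          = (\<Sum>s\<le>t. w t s * (F s * G (t - s)) - w t s * (a * b))"
        by (simp only: sum_subtractf)
      also have "\<dots> = (\<Sum>s\<le>t. w t s * (G (t - s) * (F s - a) + a * (G (t - s) - b)))"
        by (intro sum.cong refl) (rule split)
      also have "norm \<dots> \<le> (\<Sum>s\<le>t. w t s * (K * \<bar>F s - a\<bar> + \<bar>a\<bar> * \<bar>G (t - s) - b\<bar>))"
      proof (rule sum_norm_le)
        fix s
        have "\<bar>G (t - s) * (F s - a) + a * (G (t - s) - b)\<bar>
            \<le> \<bar>G (t - s)\<bar> * \<bar>F s - a\<bar> + \<bar>a\<bar> * \<bar>G (t - s) - b\<bar>"
          by (metis abs_mult abs_triangle_ineq)
        also have "\<dots> \<le> K * \<bar>F s - a\<bar> + \<bar>a\<bar> * \<bar>G (t - s) - b\<bar>"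
          using K(2)[of "t - s"] by (intro add_right_mono mult_right_mono) auto
        finally show "norm (w t s * (G (t - s) * (F s - a) + a * (G (t - s) - b)))
            \<le> w t s * (K * \<bar>F s - a\<bar> + \<bar>a\<bar> * \<bar>G (t - s) - b\<bar>)"
          using w_nonneg(1)[of t s] by (simp add: abs_mult mult_left_mono)
      qed
      also have "\<dots> = K * (\<Sum>s\<le>t. w t s * \<bar>F s - a\<bar>) + \<bar>a\<bar> * (\<Sum>s\<le>t. w t s * \<bar>G (t - s) - b\<bar>)"
        by (simp add: sum.distrib sum_distrib_left algebra_simps)
      also have "(\<Sum>s\<le>t. w t s * \<bar>G (t - s) - b\<bar>) = (\<Sum>s\<le>t. w' t s * \<bar>G s - b\<bar>)"
        by (rule reindex)
      finally show "norm (conv f g t / polyexp (Suc k) r t - a * b)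
        \<le> K * (\<Sum>s\<le>t. w t s * \<bar>F s - a\<bar>) + \<bar>a\<bar> * (\<Sum>s\<le>t. w' t s * \<bar>G s - b\<bar>)" .
    qed
  qed
  thus ?thesis by (rule LIM_zero_cancel)
qed

lemma regular_conv_summable:
  assumes f: "\<And>s. 0 \<le> f s" "summable (\<lambda>s. f s * inverse q ^ s)"
    and g: "\<And>t. 0 \<le> g t" "grows_like g k q"
  shows "regular_growth (conv f g)"
proof (cases "\<forall>s. f s = 0")
  case True
  hence "conv f g = (\<lambda>t. 0)" by (simp add: conv_def fun_eq_iff)
  thus ?thesis by (simp add: regular_zero)
next
  case False
  then obtain s where s: "f s \<noteq> 0" by blast
  from g(2) obtain c where c: "1 < q" "0 < c" "(\<lambda>t. g t / polyexp k q t) \<longlonglongrightarrow> c"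
    by (auto simp: grows_like_def)
  have "0 < f s * inverse q ^ s"
    using f(1)[of s] s c(1) by simp
  hence "0 < (\<Sum>s. f s * inverse q ^ s)"
    using f c(1) by (intro suminf_pos2[of _ s]) auto
  hence "0 < (\<Sum>s. f s * inverse q ^ s) * c" using c by simp
  moreover have "(\<lambda>t. conv f g t / polyexp k q t) \<longlonglongrightarrow> (\<Sum>s. f s * inverse q ^ s) * c"
    using c by (intro conv_summable_limit f) auto
  ultimately have "grows_like (conv f g) k q"
    using c(1) by (auto simp: grows_like_def)
  thus ?thesis using f g by (auto simp: regular_growth_def conv_nonneg)
qed

lemma subexponential_conv:
  assumes "subexponential f" "subexponential g"
  shows "subexponential (conv f g)"
  unfolding subexponential_def
proof (intro allI impI)
  fix r :: real assume "1 < r"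
  then obtain q where q: "1 < q" "q < r" using dense by blast
  have "(\<lambda>t. conv f g t / polyexp (Suc 0) q t) \<longlonglongrightarrow> 0 * 0"
    using assms q by (intro conv_same_rate_limit) (auto simp: subexponential_def)
  moreover have "polyexp (Suc 0) q t \<noteq> 0" for t
    using polyexp_pos[of q "Suc 0" t] q by simp
  ultimately show "(\<lambda>t. conv f g t / polyexp 0 r t) \<longlonglongrightarrow> 0"
    using q by (intro ratio_tendsto_0_trans[OF _ polyexp_less_rate]) auto
qed

lemma subexponential_summable:
  assumes "subexponential f" "1 < q"
  shows "summable (\<lambda>s. f s * inverse q ^ s)"
proof -
  obtain r where "1 < r" "r < q" using dense assms(2) by blast
  thus ?thesis
    using assms(1) by (intro summable_smaller_rate[of f 0 r 0]) (auto simp: subexponential_def)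
qed

text \<open>One factor is restricted to degree \<open>0\<close>, which is what powers of a single diagonal block provide;
  then the convolution of the two scales is again a scale.\<close>
lemma regular_conv:
  assumes f: "\<And>t. 0 \<le> f t" "subexponential f \<or> grows_like f 0 r"
    and g: "regular_growth g"
  shows "regular_growth (conv f g)"
proof -
  note g0 = regular_nonneg[OF g]
  have swap: "conv f g = conv g f" by (simp add: fun_eq_iff conv_commute[of f g])
  show ?thesis
  proof (cases "subexponential f"; cases "subexponential g")
    assume "subexponential f" "subexponential g"
    thus ?thesis using f g0 by (simp add: regular_growth_def subexponential_conv conv_nonneg)
  next
    assume "subexponential f" "\<not> subexponential g"
    moreover from this g obtain k q where "grows_like g k q" by (auto simp: regular_growth_def)
    ultimately show ?thesis
      using f g0 by (intro regular_conv_summable[of f q] subexponential_summable)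
        (auto simp: grows_like_def)
  next
    assume "\<not> subexponential f" "subexponential g"
    thus ?thesis
      unfolding swap using f g0 by (intro regular_conv_summable[of g r] subexponential_summable)
        (auto simp: grows_like_def)
  next
    assume "\<not> subexponential f" "\<not> subexponential g"
    with f(2) g obtain k q where fg: "grows_like f 0 r" "grows_like g k q"
      by (auto simp: regular_growth_def)
    then obtain a b where a: "1 < r" "0 < a" "(\<lambda>t. f t / polyexp 0 r t) \<longlonglongrightarrow> a"
      and b: "1 < q" "0 < b" "(\<lambda>t. g t / polyexp k q t) \<longlonglongrightarrow> b"
      by (auto simp: grows_like_def)
    consider "r < q" | "q < r" | "r = q" by linarith
    thus ?thesis
    proof cases
      case 1
      thus ?thesis
        using a by (intro regular_conv_summable[OF f(1) _ g0 fg(2)] summable_smaller_rate[OF a(3)]) auto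
    next
      case 2
      thus ?thesis
        unfolding swap
        using b by (intro regular_conv_summable[OF g0 _ f(1) fg(1)] summable_smaller_rate[OF b(3)]) auto
    next
      case 3
      have "(\<lambda>t. conv f g t / polyexp (Suc k) r t) \<longlonglongrightarrow> a * b"
        using a b 3 by (intro conv_same_rate_limit) auto
      hence "grows_like (conv f g) (Suc k) r"
        using a b by (intro grows_likeI[of r "a * b"]) auto
      thus ?thesis using f g0 by (auto simp: regular_growth_def conv_nonneg)
    qed
  qed
qed

section \<open>Powers of matrices on arbitrary index sets\<close>

text \<open>The \<open>(i, j)\<close> entry of the \<open>t\<close>-th power of the submatrix of \<open>A\<close> with rows and columns in \<open>I\<close>, that
  is, the weighted number of paths of length \<open>t\<close> from \<open>j\<close> to \<open>i\<close> inside \<open>I\<close>. Keeping the original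
  indices makes it possible to compare powers of a diagonal block with powers of the whole matrix.\<close>
primrec mpow :: "nat set \<Rightarrow> (nat \<Rightarrow> nat \<Rightarrow> 'a::comm_semiring_1) \<Rightarrow> nat \<Rightarrow> nat \<Rightarrow> nat \<Rightarrow> 'a" where
  "mpow I A 0 = (\<lambda>i j. if i = j then 1 else 0)"
| "mpow I A (Suc t) = (\<lambda>i j. \<Sum>l\<in>I. A i l * mpow I A t l j)"

declare mpow.simps(2) [simp del]
lemmas mpow_Suc = mpow.simps(2) [THEN fun_cong, THEN fun_cong]

lemma mpow_add:
  assumes "finite I" "i \<in> I"
  shows "mpow I A (s + t) i j = (\<Sum>l\<in>I. mpow I A s i l * mpow I A t l j)"
  using assms(2)
proof (induction s arbitrary: i)
  case 0
  have "(\<Sum>l\<in>I. mpow I A 0 i l * mpow I A t l j) = (\<Sum>l\<in>I. if l = i then mpow I A t l j else 0)"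
    by (intro sum.cong) auto
  thus ?case using 0 assms(1) by simp
next
  case (Suc s)
  have "mpow I A (Suc s + t) i j = (\<Sum>m\<in>I. A i m * (\<Sum>l\<in>I. mpow I A s m l * mpow I A t l j))"
    using Suc.IH by (simp add: mpow_Suc)
  also have "\<dots> = (\<Sum>m\<in>I. \<Sum>l\<in>I. A i m * mpow I A s m l * mpow I A t l j)"
    by (simp add: sum_distrib_left mult.assoc)
  also have "\<dots> = (\<Sum>l\<in>I. mpow I A (Suc s) i l * mpow I A t l j)"
    by (subst sum.swap) (simp add: mpow_Suc sum_distrib_right)
  finally show ?case .
qed

lemma mpow_1:
  assumes "finite I" "j \<in> I"
  shows "mpow I A 1 i j = A i j"
proof -
  have "mpow I A 1 i j = (\<Sum>l\<in>I. if l = j then A i l else 0)"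
    unfolding One_nat_def mpow_Suc by (intro sum.cong) auto
  thus ?thesis using assms by simp
qed

lemma mpow_Suc_right:
  assumes "finite I" "i \<in> I" "j \<in> I"
  shows "mpow I A (Suc t) i j = (\<Sum>l\<in>I. mpow I A t i l * A l j)"
proof -
  have "mpow I A (t + 1) i j = (\<Sum>l\<in>I. mpow I A t i l * mpow I A 1 l j)"
    by (rule mpow_add[OF assms(1,2)])
  also have "\<dots> = (\<Sum>l\<in>I. mpow I A t i l * A l j)"
    by (simp only: mpow_1[OF assms(1,3)])
  finally show ?thesis by simp
qed

lemma mpow_transpose:
  assumes "finite I" "i \<in> I" "j \<in> I"
  shows "mpow I (\<lambda>i j. A j i) t i j = mpow I A t j i"
  using assms(2)
proof (induction t arbitrary: i)
  case (Suc t)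
  thus ?case
    using mpow_Suc_right[OF assms(1,3) Suc.prems, of A t] by (simp add: mpow_Suc mult.commute)
qed auto

lemma mpow_nonneg:
  fixes A :: "nat \<Rightarrow> nat \<Rightarrow> 'a::linordered_idom"
  assumes "\<And>i j. i \<in> I \<Longrightarrow> j \<in> I \<Longrightarrow> 0 \<le> A i j" "i \<in> I"
  shows "0 \<le> mpow I A t i j"
  using assms(2) by (induction t arbitrary: i) (auto simp: mpow_Suc assms(1) intro!: sum_nonneg mult_nonneg_nonneg)

lemma mpow_of_int: "mpow I (\<lambda>i j. of_int (A i j)) t i j = of_int (mpow I A t i j)"
  by (induction t arbitrary: i) (auto simp: mpow_Suc)

lemma mpow_mono_subset:
  fixes A :: "nat \<Rightarrow> nat \<Rightarrow> 'a::linordered_idom"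
  assumes "finite J" "I \<subseteq> J" "\<And>i j. i \<in> J \<Longrightarrow> j \<in> J \<Longrightarrow> 0 \<le> A i j" "i \<in> I"
  shows "mpow I A t i j \<le> mpow J A t i j"
  using assms(4)
proof (induction t arbitrary: i)
  case (Suc t)
  have i: "i \<in> J" using Suc.prems assms(2) by blast
  have "(\<Sum>l\<in>I. A i l * mpow I A t l j) \<le> (\<Sum>l\<in>I. A i l * mpow J A t l j)"
  proof (intro sum_mono mult_left_mono)
    show "0 \<le> A i l" if "l \<in> I" for l
      using that assms(2) by (intro assms(3) i) blast
  qed (rule Suc.IH)
  also have "\<dots> \<le> (\<Sum>l\<in>J. A i l * mpow J A t l j)"
    using assms i by (intro sum_mono2 mult_nonneg_nonneg mpow_nonneg) auto
  finally show ?case by (simp add: mpow_Suc)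
qed simp

lemma mpow_mult_le_add:
  fixes A :: "nat \<Rightarrow> nat \<Rightarrow> 'a::linordered_idom"
  assumes "finite I" "\<And>i j. i \<in> I \<Longrightarrow> j \<in> I \<Longrightarrow> 0 \<le> A i j" "i \<in> I" "l \<in> I"
  shows "mpow I A s i l * mpow I A t l j \<le> mpow I A (s + t) i j"
proof -
  have "(\<Sum>l\<in>{l}. mpow I A s i l * mpow I A t l j) \<le> (\<Sum>l\<in>I. mpow I A s i l * mpow I A t l j)"
    using assms by (intro sum_mono2 mult_nonneg_nonneg mpow_nonneg) auto
  thus ?thesis by (simp add: mpow_add[OF assms(1,3)])
qed

lemma mpow_power_le:
  fixes A :: "nat \<Rightarrow> nat \<Rightarrow> 'a::linordered_idom"
  assumes "finite I" "\<And>i j. i \<in> I \<Longrightarrow> j \<in> I \<Longrightarrow> 0 \<le> A i j" "l \<in> I"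
  shows "mpow I A K l l ^ m \<le> mpow I A (K * m) l l"
proof (induction m)
  case (Suc m)
  have "mpow I A K l l ^ Suc m \<le> mpow I A K l l * mpow I A (K * m) l l"
    using Suc assms by (simp add: mult_left_mono mpow_nonneg)
  also have "\<dots> \<le> mpow I A (K + K * m) l l"
    by (rule mpow_mult_le_add) (use assms in auto)
  finally show ?case by simp
qed simp

section \<open>The Perron-Frobenius limit for primitive matrices\<close>

locale primitive_matrix =
  fixes I :: "nat set" and A :: "nat \<Rightarrow> nat \<Rightarrow> real" and k :: nat
  assumes fin: "finite I" and ne: "I \<noteq> {}"
    and nonneg: "\<And>i j. i \<in> I \<Longrightarrow> j \<in> I \<Longrightarrow> 0 \<le> A i j"
    and k: "1 \<le> k" and pos: "\<And>i j. i \<in> I \<Longrightarrow> j \<in> I \<Longrightarrow> 0 < mpow I A k i j"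
begin

abbreviation P :: "nat \<Rightarrow> nat \<Rightarrow> nat \<Rightarrow> real" where
  "P \<equiv> mpow I A"

lemma P_transpose: "i \<in> I \<Longrightarrow> j \<in> I \<Longrightarrow> mpow I (\<lambda>i j. A j i) t i j = P t j i"
  by (rule mpow_transpose[OF fin])

lemma transpose: "primitive_matrix I (\<lambda>i j. A j i) k"
  by unfold_locales (use fin ne nonneg k pos in \<open>auto simp: P_transpose\<close>)

definition rowsum :: "nat \<Rightarrow> nat \<Rightarrow> real" where
  "rowsum t i = (\<Sum>j\<in>I. P t i j)"

lemma P_nonneg: "i \<in> I \<Longrightarrow> 0 \<le> P t i j"
  by (rule mpow_nonneg[OF nonneg])

lemma rowsum_add: "i \<in> I \<Longrightarrow> rowsum (s + t) i = (\<Sum>l\<in>I. P s i l * rowsum t l)"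
  unfolding rowsum_def by (simp add: mpow_add[OF fin] sum_distrib_left) (rule sum.swap)

lemma rowsum_pos: "i \<in> I \<Longrightarrow> 0 < rowsum t i"
proof (induction t arbitrary: i)
  case 0
  thus ?case using fin by (simp add: rowsum_def)
next
  case (Suc t)
  obtain k' where k': "k = Suc k'" using k by (cases k) auto
  have "\<exists>l\<in>I. A i l \<noteq> 0"
  proof (rule ccontr)
    assume "\<not> (\<exists>l\<in>I. A i l \<noteq> 0)"
    hence "P k i i = 0" by (simp add: k' mpow_Suc)
    thus False using pos[of i i] Suc.prems by simp
  qed
  then obtain l where l: "l \<in> I" "A i l \<noteq> 0" by blast
  have "rowsum (Suc t) i = (\<Sum>l\<in>I. P 1 i l * rowsum t l)"
    using rowsum_add[of i 1 t] Suc.prems by simp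
  also have "\<dots> = (\<Sum>l\<in>I. A i l * rowsum t l)"
    by (intro sum.cong) (simp_all add: mpow_1[OF fin] flip: One_nat_def)
  also have "0 < \<dots>"
  proof (rule sum_pos2[OF fin l(1)])
    show "0 < A i l * rowsum t l"
      using l nonneg[OF Suc.prems l(1)] Suc.IH[OF l(1)] by simp
    show "0 \<le> A i m * rowsum t m" if "m \<in> I" for m
      using nonneg[OF Suc.prems that] Suc.IH[OF that] by simp
  qed
  finally show ?case .
qed

text \<open>The quotients of an entry by its row sum satisfy an averaging recursion: the quotients at time
  \<open>s + t\<close> are averages, with these weights, of those at time \<open>t\<close> (\<open>ratio_weighted_average\<close>).\<close>
definition weight :: "nat \<Rightarrow> nat \<Rightarrow> nat \<Rightarrow> nat \<Rightarrow> real" where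
  "weight s t i l = P s i l * rowsum t l / rowsum (s + t) i"

lemma weight_nonneg: "i \<in> I \<Longrightarrow> l \<in> I \<Longrightarrow> 0 \<le> weight s t i l"
  by (simp add: weight_def P_nonneg rowsum_pos less_imp_le)

lemma weight_sum: "i \<in> I \<Longrightarrow> (\<Sum>l\<in>I. weight s t i l) = 1"
  using rowsum_pos[of i "s + t"] rowsum_add[of i s t]
  by (simp add: weight_def flip: sum_divide_distrib)

lemma ratio_weighted_average:
  assumes "i \<in> I"
  shows "P (s + t) i j / rowsum (s + t) i = (\<Sum>l\<in>I. weight s t i l * (P t l j / rowsum t l))"
proof -
  have "weight s t i l * (P t l j / rowsum t l) = P s i l * P t l j / rowsum (s + t) i" if "l \<in> I" for l
    using rowsum_pos[OF that, of t] by (simp add: weight_def)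
  thus ?thesis
    using assms by (simp add: mpow_add[OF fin] sum_divide_distrib)
qed

text \<open>After \<open>k\<close> steps all row sums agree up to the factor \<open>b / a\<close>, where \<open>a\<close> and \<open>b\<close> are the least and the
  greatest entry of the \<open>k\<close>-th power. This bounds the weights uniformly in the time.\<close>
lemma weight_lower_bound: "\<exists>\<delta>>0. \<forall>t\<ge>k. \<forall>i\<in>I. \<forall>l\<in>I. \<delta> \<le> weight k t i l"
proof -
  let ?E = "(\<lambda>(i, j). P k i j) ` (I \<times> I)"
  define a where "a = Min ?E"
  define b where "b = Max ?E"
  have E: "finite ?E" "?E \<noteq> {}" using fin ne by auto
  have a: "a \<le> P k i j" and b: "P k i j \<le> b" if "i \<in> I" "j \<in> I" for i j
    using that E(1) by (auto simp: a_def b_def intro!: Min_le Max_ge)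
  have a0: "0 < a" using Min_in[OF E] pos by (auto simp: a_def)
  have b0: "0 < b" using ne a b a0 by (metis all_not_in_conv less_le_trans)
  have c0: "0 < real (card I)" using fin ne by (simp add: card_gt_0_iff)
  have "a * a / (card I * (b * b)) \<le> weight k t i l" if t: "t \<ge> k" and il: "i \<in> I" "l \<in> I" for t i l
  proof -
    obtain u where u: "t = k + u" using t le_iff_add by blast
    define X where "X = (\<Sum>q\<in>I. rowsum u q)"
    have X: "0 < X" unfolding X_def using fin ne rowsum_pos by (intro sum_pos) auto
    have lo: "a * X \<le> rowsum t l'" and hi: "rowsum t l' \<le> b * X" if "l' \<in> I" for l'
      unfolding u rowsum_add[OF that] X_def sum_distrib_left
      using a b that by (auto intro!: sum_mono mult_right_mono less_imp_le[OF rowsum_pos])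
    have num: "a * (a * X) \<le> P k i l * rowsum t l"
      using a[OF il] lo[OF il(2)] a0 X P_nonneg il by (intro mult_mono) auto
    have "rowsum (k + t) i \<le> (\<Sum>l\<in>I. b * (b * X))"
      unfolding rowsum_add[OF il(1)]
      using b hi b0 X il rowsum_pos by (intro sum_mono mult_mono) (auto intro: less_imp_le)
    hence den: "rowsum (k + t) i \<le> card I * (b * (b * X))" by simp
    have "a * a / (card I * (b * b)) = a * (a * X) / (card I * (b * (b * X)))"
      using X b0 by simp
    also have "\<dots> \<le> weight k t i l"
      unfolding weight_def
    proof (rule frac_le)
      show "0 \<le> P k i l * rowsum t l"
        using P_nonneg[OF il(1)] rowsum_pos[OF il(2)] by (simp add: less_imp_le)
    qed (use num den rowsum_pos[OF il(1)] in auto)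
    finally show ?thesis .
  qed
  moreover have "0 < a * a / (card I * (b * b))" using a0 b0 c0 by simp
  ultimately show ?thesis by blast
qed

text \<open>The largest quotient in a column decreases, the smallest one increases, and \<open>k\<close> averaging steps with
  weights at least \<open>d\<close> take the \<open>d\<close>-th part off their difference. Hence the difference tends to \<open>0\<close>. The
  common limit is positive because at time \<open>k\<close> the smallest quotient already is.\<close>
lemma ratio_convergent:
  assumes j: "j \<in> I"
  shows "\<exists>\<rho>>0. \<forall>i\<in>I. (\<lambda>t. P t i j / rowsum t i) \<longlonglongrightarrow> \<rho>"
proof -
  define r where "r t i = P t i j / rowsum t i" for t i
  define hi where "hi t = Max (r t ` I)" for t
  define lo where "lo t = Min (r t ` I)" for t
  have le_hi: "r t i \<le> hi t" and lo_le: "lo t \<le> r t i" if "i \<in> I" for t i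
    using that fin by (auto simp: hi_def lo_def)
  have hi_in: "\<exists>i\<in>I. hi t = r t i" and lo_in: "\<exists>i\<in>I. lo t = r t i" for t
    using Max_in[of "r t ` I"] Min_in[of "r t ` I"] fin ne unfolding hi_def lo_def
    by (fastforce simp: image_iff)+
  have avg: "r (s + t) i = (\<Sum>l\<in>I. weight s t i l * r t l)" if "i \<in> I" for s t i
    unfolding r_def by (rule ratio_weighted_average[OF that])
  have avg_le: "r (s + t) i + d * (hi t - lo t) \<le> hi t"
    if i: "i \<in> I" and d: "\<And>l. l \<in> I \<Longrightarrow> d \<le> weight s t i l" for s t i d
  proof -
    obtain l where l: "l \<in> I" "lo t = r t l" using lo_in by blast
    have "hi t - r (s + t) i = (\<Sum>m\<in>I. weight s t i m * (hi t - r t m))"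
      using weight_sum[OF i, of s t] unfolding avg[OF i] right_diff_distrib sum_subtractf
      by (simp flip: sum_distrib_right)
    also have "\<dots> \<ge> weight s t i l * (hi t - r t l)"
      using l fin le_hi weight_nonneg[OF i] by (intro member_le_sum) auto
    also have "weight s t i l * (hi t - r t l) \<ge> d * (hi t - r t l)"
      using d[OF l(1)] le_hi[OF l(1)] by (intro mult_right_mono) auto
    finally show ?thesis using l by simp
  qed
  have hi_step: "hi (s + t) + d * (hi t - lo t) \<le> hi t"
    if "\<And>i l. i \<in> I \<Longrightarrow> l \<in> I \<Longrightarrow> d \<le> weight s t i l" for s t d
    using avg_le hi_in[of "s + t"] that by metis
  have lo_step: "lo t \<le> lo (s + t)" for s t
  proof -
    obtain i where i: "i \<in> I" "lo (s + t) = r (s + t) i" using lo_in by blast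
    have "lo t = (\<Sum>l\<in>I. weight s t i l * lo t)"
      using weight_sum[OF i(1), of s t] by (simp flip: sum_distrib_right)
    also have "\<dots> \<le> r (s + t) i"
      unfolding avg[OF i(1)] using weight_nonneg[OF i(1)] lo_le by (intro sum_mono mult_left_mono)
    finally show ?thesis using i by simp
  qed
  have lo_hi: "lo t \<le> hi t" for t
    using le_hi lo_le ne by (meson all_not_in_conv order_trans)
  have "decseq hi"
    using hi_step[of 0 1] weight_nonneg by (intro decseq_SucI) auto
  moreover have "incseq lo"
    using lo_step[of _ 1] by (intro incseq_SucI) auto
  ultimately have "lo 0 \<le> hi t" "lo t \<le> hi 0" for t
    using lo_hi[of t] decseqD[of hi 0 t] incseqD[of lo 0 t] by auto
  with \<open>decseq hi\<close> \<open>incseq lo\<close> obtain H L where H: "hi \<longlonglongrightarrow> H" and L: "lo \<longlonglongrightarrow> L"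
    by (metis decseq_convergent incseq_convergent)
  obtain d where d: "0 < d" "\<And>t i l. t \<ge> k \<Longrightarrow> i \<in> I \<Longrightarrow> l \<in> I \<Longrightarrow> d \<le> weight k t i l"
    using weight_lower_bound by blast
  \<comment> \<open>In the limit the oscillation \<open>H - L\<close> is at most \<open>1 - d\<close> times itself.\<close>
  have "H + d * (H - L) \<le> H"
  proof (rule LIMSEQ_le)
    show "(\<lambda>t. hi (k + t) + d * (hi t - lo t)) \<longlonglongrightarrow> H + d * (H - L)"
      using LIMSEQ_ignore_initial_segment[OF H, of k]
      by (intro tendsto_intros H L) (simp add: add.commute)
    show "hi \<longlonglongrightarrow> H" by (rule H)
    show "\<exists>N. \<forall>t\<ge>N. hi (k + t) + d * (hi t - lo t) \<le> hi t"
      using hi_step d(2) by blast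
  qed
  moreover have "L \<le> H"
    using LIMSEQ_le[OF L H] lo_hi by blast
  ultimately have HL: "H = L"
    using d(1) by (simp add: mult_le_0_iff)
  have "(\<lambda>t. r t i) \<longlonglongrightarrow> L" if "i \<in> I" for i
    using tendsto_sandwich[of lo "\<lambda>t. r t i" sequentially hi L] L H HL le_hi lo_le that
    by (simp add: always_eventually)
  moreover have "0 < L"
  proof -
    obtain i where "i \<in> I" "lo k = r k i" using lo_in by blast
    hence "0 < lo k" using pos[OF _ j] rowsum_pos by (simp add: r_def)
    also have "lo k \<le> L" using incseq_le[OF \<open>incseq lo\<close> L] .
    finally show ?thesis .
  qed
  ultimately show ?thesis unfolding r_def by blast
qed

text \<open>The limits of the quotients of entries by row sums form a left eigenvector: one more factor \<open>A\<close>
  multiplies all the row sums asymptotically by the same number \<open>r\<close>.\<close>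
lemma left_eigenvector:
  "\<exists>\<rho> r. 0 < r \<and> (\<forall>j\<in>I. 0 < \<rho> j \<and> (\<Sum>l\<in>I. \<rho> l * A l j) = r * \<rho> j)"
proof -
  obtain \<rho> where \<rho>: "\<And>j. j \<in> I \<Longrightarrow> 0 < \<rho> j" "\<And>i j. i \<in> I \<Longrightarrow> j \<in> I \<Longrightarrow> (\<lambda>t. P t i j / rowsum t i) \<longlonglongrightarrow> \<rho> j"
    using ratio_convergent by metis
  define \<sigma> where "\<sigma> j = (\<Sum>l\<in>I. \<rho> l * A l j)" for j
  obtain i where i: "i \<in> I" using ne by blast
  have step: "(\<lambda>t. P (Suc t) i j / rowsum t i) \<longlonglongrightarrow> \<sigma> j" if "j \<in> I" for j
  proof -
    have "(\<lambda>t. \<Sum>l\<in>I. P t i l / rowsum t i * A l j) \<longlonglongrightarrow> \<sigma> j"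
      unfolding \<sigma>_def by (intro tendsto_sum tendsto_mult tendsto_const \<rho> i)
    thus ?thesis
      by (simp add: mpow_Suc_right[OF fin i that] sum_divide_distrib)
  qed
  define r where "r = (\<Sum>j\<in>I. \<sigma> j)"
  have "(\<lambda>t. \<Sum>j\<in>I. P (Suc t) i j / rowsum t i) \<longlonglongrightarrow> r"
    unfolding r_def by (intro tendsto_sum step)
  hence rowsum_step: "(\<lambda>t. rowsum (Suc t) i / rowsum t i) \<longlonglongrightarrow> r"
    by (simp add: rowsum_def sum_divide_distrib)
  have eig: "\<sigma> j = r * \<rho> j" if "j \<in> I" for j
  proof -
    have "(\<lambda>t. rowsum (Suc t) i / rowsum t i * (P (Suc t) i j / rowsum (Suc t) i)) \<longlonglongrightarrow> r * \<rho> j"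
      by (intro tendsto_mult rowsum_step LIMSEQ_Suc \<rho> i that)
    moreover have "rowsum (Suc t) i / rowsum t i * (P (Suc t) i j / rowsum (Suc t) i)
        = P (Suc t) i j / rowsum t i" for t
      using rowsum_pos[OF i, of "Suc t"] by simp
    ultimately show ?thesis
      using step[OF that] by (simp add: LIMSEQ_unique)
  qed
  have "0 < r"
  proof -
    have "0 \<le> \<sigma> j" if "j \<in> I" for j
      unfolding \<sigma>_def using \<rho>(1) nonneg that by (intro sum_nonneg mult_nonneg_nonneg) (auto intro: less_imp_le)
    hence "0 \<le> r" unfolding r_def by (rule sum_nonneg)
    moreover have "r \<noteq> 0"
    proof
      assume "r = 0"
      hence \<sigma>0: "(\<Sum>l\<in>I. \<rho> l * A l i) = 0" using eig[OF i] by (simp add: \<sigma>_def)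
      have "0 \<le> \<rho> l * A l i" if "l \<in> I" for l
        using \<rho>(1)[OF that] nonneg[OF that i] by simp
      hence "\<forall>l\<in>I. \<rho> l * A l i = 0"
        using \<sigma>0 sum_nonneg_eq_0_iff[OF fin, of "\<lambda>l. \<rho> l * A l i"] by blast
      hence "\<forall>l\<in>I. A l i = 0" using \<rho>(1) by force
      moreover obtain k' where "k = Suc k'" using k by (cases k) auto
      ultimately have "P k i i = 0" by (simp add: mpow_Suc_right[OF fin i i])
      thus False using pos[OF i i] by simp
    qed
    ultimately show ?thesis by simp
  qed
  with \<rho>(1) eig show ?thesis unfolding \<sigma>_def by blast
qed

text \<open>The transposed matrix is primitive as well, so the quotients by the column sums converge too. Pairing
  a column with the left eigenvector \<open>\<rho>\<close> gives exactly \<open>r\<^sup>t \<rho>\<^sub>j\<close>, which determines the growth of the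
  column sums and hence of all entries.\<close>
theorem perron_frobenius_limit:
  "\<exists>r>0. \<forall>i\<in>I. \<forall>j\<in>I. \<exists>c>0. (\<lambda>t. P t i j / r ^ t) \<longlonglongrightarrow> c"
proof -
  obtain \<rho> r where r: "0 < r" and \<rho>: "\<And>j. j \<in> I \<Longrightarrow> 0 < \<rho> j"
      "\<And>j. j \<in> I \<Longrightarrow> (\<Sum>l\<in>I. \<rho> l * A l j) = r * \<rho> j"
    using left_eigenvector by blast
  have \<rho>_pow: "(\<Sum>l\<in>I. \<rho> l * P t l j) = r ^ t * \<rho> j" if "j \<in> I" for t j
    using that
  proof (induction t arbitrary: j)
    case 0
    have "(\<Sum>l\<in>I. \<rho> l * P 0 l j) = (\<Sum>l\<in>I. if l = j then \<rho> l else 0)"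
      by (intro sum.cong) auto
    thus ?case using 0 fin by simp
  next
    case (Suc t)
    have "(\<Sum>l\<in>I. \<rho> l * P (Suc t) l j) = (\<Sum>l\<in>I. \<Sum>m\<in>I. \<rho> l * P t l m * A m j)"
      using Suc.prems by (intro sum.cong) (simp_all add: mpow_Suc_right[OF fin] sum_distrib_left mult.assoc)
    also have "\<dots> = (\<Sum>m\<in>I. (\<Sum>l\<in>I. \<rho> l * P t l m) * A m j)"
      by (subst sum.swap) (simp add: sum_distrib_right)
    also have "\<dots> = r ^ t * (\<Sum>m\<in>I. \<rho> m * A m j)"
      using Suc.IH by (simp add: sum_distrib_left mult.assoc)
    finally show ?case using \<rho>(2)[OF Suc.prems] by simp
  qed
  interpret T: primitive_matrix I "\<lambda>i j. A j i" k by (rule transpose)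
  define colsum where "colsum t j = (\<Sum>i\<in>I. P t i j)" for t j
  have T_rowsum: "T.rowsum t j = colsum t j" if "j \<in> I" for t j
    unfolding T.rowsum_def colsum_def using that by (simp add: P_transpose)
  obtain \<sigma> where \<sigma>: "\<And>i. i \<in> I \<Longrightarrow> 0 < \<sigma> i"
      "\<And>i j. i \<in> I \<Longrightarrow> j \<in> I \<Longrightarrow> (\<lambda>t. T.P t j i / T.rowsum t j) \<longlonglongrightarrow> \<sigma> i"
    using T.ratio_convergent by metis
  have \<sigma>_lim: "(\<lambda>t. P t i j / colsum t j) \<longlonglongrightarrow> \<sigma> i" if "i \<in> I" "j \<in> I" for i j
    using \<sigma>(2)[OF that] that by (simp add: T_rowsum P_transpose)
  define \<kappa> where "\<kappa> = (\<Sum>l\<in>I. \<rho> l * \<sigma> l)"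
  have \<kappa>: "0 < \<kappa>" unfolding \<kappa>_def using fin ne \<rho>(1) \<sigma>(1) by (intro sum_pos) auto
  have "(\<lambda>t. P t i j / r ^ t) \<longlonglongrightarrow> \<sigma> i / (\<kappa> / \<rho> j)" if ij: "i \<in> I" "j \<in> I" for i j
  proof -
    have "(\<lambda>t. (\<Sum>l\<in>I. \<rho> l * (P t l j / colsum t j)) / \<rho> j) \<longlonglongrightarrow> \<kappa> / \<rho> j"
      unfolding \<kappa>_def using \<rho>(1)[OF ij(2)] by (intro tendsto_intros \<sigma>_lim ij) auto
    moreover have "(\<Sum>l\<in>I. \<rho> l * (P t l j / colsum t j)) / \<rho> j = r ^ t / colsum t j" for t
    proof -
      have "(\<Sum>l\<in>I. \<rho> l * (P t l j / colsum t j)) = (\<Sum>l\<in>I. \<rho> l * P t l j) / colsum t j"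
        by (simp add: sum_divide_distrib)
      thus ?thesis using \<rho>_pow[OF ij(2)] \<rho>(1)[OF ij(2)] by simp
    qed
    ultimately have "(\<lambda>t. r ^ t / colsum t j) \<longlonglongrightarrow> \<kappa> / \<rho> j" by simp
    moreover have "\<kappa> / \<rho> j \<noteq> 0" using \<kappa> \<rho>(1)[OF ij(2)] by simp
    ultimately have lim: "(\<lambda>t. P t i j / colsum t j / (r ^ t / colsum t j)) \<longlonglongrightarrow> \<sigma> i / (\<kappa> / \<rho> j)"
      using tendsto_divide[OF \<sigma>_lim[OF ij]] by blast
    have "P t i j / colsum t j / (r ^ t / colsum t j) = P t i j / r ^ t" for t
      using T.rowsum_pos[OF ij(2), of t] T_rowsum[OF ij(2), of t] by simp
    with lim show ?thesis by (simp only:)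
  qed
  moreover have "0 < \<sigma> i / (\<kappa> / \<rho> j)" if "i \<in> I" "j \<in> I" for i j
    using \<sigma>(1) \<rho>(1) \<kappa> that by simp
  ultimately show ?thesis using r by blast
qed

text \<open>The case \<open>r \<le> 1\<close> (which includes the block \<open>[1]\<close>) falls under subexponential growth.\<close>
lemma block_growth:
  assumes "i \<in> I" "j \<in> I"
  shows "subexponential (\<lambda>t. P t i j) \<or> (\<exists>r. grows_like (\<lambda>t. P t i j) 0 r)"
proof -
  obtain r c where r: "0 < r" "0 < c" "(\<lambda>t. P t i j / polyexp 0 r t) \<longlonglongrightarrow> c"
    using perron_frobenius_limit assms unfolding polyexp_0 by blast
  show ?thesis
  proof (cases "1 < r")
    case True
    thus ?thesis using r by (auto simp: grows_like_def)
  next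
    case False
    have "subexponential (\<lambda>t. P t i j)"
      unfolding subexponential_def
    proof (intro allI impI)
      fix q :: real assume "1 < q"
      with False have "r < q" by simp
      moreover have "polyexp 0 r t \<noteq> 0" for t using r by (simp add: polyexp_0)
      ultimately show "(\<lambda>t. P t i j / polyexp 0 q t) \<longlonglongrightarrow> 0"
        using r by (intro ratio_tendsto_0_trans[OF r(3) polyexp_less_rate]) auto
    qed
    thus ?thesis ..
  qed
qed

end

lemma bounded_subexponential:
  assumes "\<And>t. 0 \<le> f t" "\<And>t. f t \<le> C"
  shows "subexponential f"
  unfolding subexponential_def
proof (intro allI impI)
  fix r :: real assume r: "1 < r"
  have "(\<lambda>t. C * inverse r ^ t) \<longlonglongrightarrow> 0"
    using r by (intro tendsto_mult_right_zero LIMSEQ_power_zero) (auto simp: field_simps)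
  thus "(\<lambda>t. f t / polyexp 0 r t) \<longlonglongrightarrow> 0"
  proof (rule Lim_null_comparison[rotated])
    show "\<forall>\<^sub>F t in sequentially. norm (f t / polyexp 0 r t) \<le> C * inverse r ^ t"
      using assms r by (auto simp: polyexp_0 abs_mult divide_inverse power_inverse intro!: always_eventually mult_right_mono)
  qed
qed

section \<open>Linear recursions with a source\<close>

lemma conv_0: "conv f g 0 = f 0 * g 0"
  by (simp add: conv_def)

lemma conv_Suc: "conv f g (Suc t) = f 0 * g (Suc t) + conv (\<lambda>s. f (Suc s)) g t"
  unfolding conv_def sum.atMost_Suc_shift by simp

text \<open>The initial value is treated as a source at time \<open>0\<close>, so that the solution is one single convolution.\<close>
lemma variation_of_constants:
  fixes z :: "nat \<Rightarrow> nat \<Rightarrow> real"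
  assumes I: "finite I"
    and z: "\<And>t i. i \<in> I \<Longrightarrow> z (Suc t) i = (\<Sum>j\<in>I. A i j * z t j) + b t i"
    and i: "i \<in> I"
  shows "z t i = (\<Sum>j\<in>I. conv (\<lambda>s. mpow I A s i j) (\<lambda>s. case s of 0 \<Rightarrow> z 0 j | Suc s \<Rightarrow> b s j) t)"
  using i
proof (induction t arbitrary: i)
  case 0
  have "(\<Sum>j\<in>I. mpow I A 0 i j * z 0 j) = (\<Sum>j\<in>I. if j = i then z 0 j else 0)"
    by (intro sum.cong) auto
  thus ?case using 0 I by (simp add: conv_0)
next
  case (Suc t)
  define g where "g j = (\<lambda>s. case s of 0 \<Rightarrow> z 0 j | Suc s \<Rightarrow> b s j)" for j
  have shift: "conv (\<lambda>s. mpow I A (Suc s) i j) (g j) t = (\<Sum>l\<in>I. A i l * conv (\<lambda>s. mpow I A s l j) (g j) t)" for j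
  proof -
    have "conv (\<lambda>s. mpow I A (Suc s) i j) (g j) t = (\<Sum>s\<le>t. \<Sum>l\<in>I. A i l * (mpow I A s l j * g j (t - s)))"
      by (simp add: conv_def mpow_Suc sum_distrib_right mult.assoc)
    also have "\<dots> = (\<Sum>l\<in>I. A i l * conv (\<lambda>s. mpow I A s l j) (g j) t)"
      by (subst sum.swap) (simp add: conv_def sum_distrib_left)
    finally show ?thesis .
  qed
  have source: "(\<Sum>j\<in>I. mpow I A 0 i j * b t j) = b t i"
  proof -
    have "(\<Sum>j\<in>I. mpow I A 0 i j * b t j) = (\<Sum>j\<in>I. if j = i then b t j else 0)"
      by (intro sum.cong) auto
    thus ?thesis using Suc.prems I by simp
  qed
  have "(\<Sum>j\<in>I. conv (\<lambda>s. mpow I A s i j) (g j) (Suc t))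
      = b t i + (\<Sum>j\<in>I. \<Sum>l\<in>I. A i l * conv (\<lambda>s. mpow I A s l j) (g j) t)"
    unfolding conv_Suc sum.distrib shift source[symmetric] by (simp add: g_def)
  also have "\<dots> = b t i + (\<Sum>l\<in>I. A i l * (\<Sum>j\<in>I. conv (\<lambda>s. mpow I A s l j) (g j) t))"
    by (subst sum.swap) (simp add: sum_distrib_left)
  also have "\<dots> = b t i + (\<Sum>l\<in>I. A i l * z t l)"
    using Suc.IH by (simp add: g_def)
  finally show ?case
    using z[OF Suc.prems] by (simp add: g_def)
qed

section \<open>Closed classes with bounded powers contain a periodic vector\<close>

lemma nonneg_int_sum_eq_1:
  fixes f :: "nat \<Rightarrow> int"
  assumes "finite I" "\<And>l. l \<in> I \<Longrightarrow> 0 \<le> f l" "(\<Sum>l\<in>I. f l) = 1"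
  obtains u where "u \<in> I" "\<And>l. l \<in> I \<Longrightarrow> f l = (if l = u then 1 else 0)"
proof -
  have "\<exists>u\<in>I. f u \<noteq> 0"
  proof (rule ccontr)
    assume "\<not> (\<exists>u\<in>I. f u \<noteq> 0)"
    thus False using assms(3) by simp
  qed
  then obtain u where u: "u \<in> I" "f u \<noteq> 0" by blast
  have split: "f u + (\<Sum>l\<in>I - {u}. f l) = 1"
    using assms(1,3) u(1) by (simp add: sum.remove)
  have rest: "0 \<le> (\<Sum>l\<in>I - {u}. f l)"
    using assms(2) by (intro sum_nonneg) auto
  have "0 < f u" using assms(2)[OF u(1)] u(2) by simp
  with split rest have fu: "f u = 1" and "(\<Sum>l\<in>I - {u}. f l) = 0" by auto
  hence "\<forall>l\<in>I - {u}. f l = 0"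
    using assms(1,2) by (subst (asm) sum_nonneg_eq_0_iff) auto
  with fu u(1) show thesis by (intro that[of u]) auto
qed

lemma closed_class_support:
  fixes M :: "nat \<Rightarrow> nat \<Rightarrow> int"
  assumes Q: "\<And>j l. j \<in> Q \<Longrightarrow> l \<in> I \<Longrightarrow> M l j \<noteq> 0 \<Longrightarrow> l \<in> Q"
    and "j \<in> Q" "l \<in> I" "mpow I M t l j \<noteq> 0"
  shows "l \<in> Q"
  using assms(3,4)
proof (induction t arbitrary: l)
  case 0
  thus ?case using assms(2) by (auto split: if_splits)
next
  case (Suc t)
  have "\<exists>m\<in>I. M l m * mpow I M t m j \<noteq> 0"
    using Suc.prems(2) unfolding mpow_Suc by (rule contrapos_np) (simp add: sum.neutral)
  then obtain m where "m \<in> I" "M l m \<noteq> 0" "mpow I M t m j \<noteq> 0" by auto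
  thus ?case using Suc.IH Q Suc.prems(1) by blast
qed

text \<open>Column sums of powers are integers that do not decrease, because every column sum of \<open>M\<close> on the class
  is at least \<open>1\<close>. Where the column sum of \<open>j\<close> is largest, at time \<open>T\<close>, every coordinate \<open>m\<close> in the
  support must have column sum \<open>1\<close> in every power. So the powers of \<open>M\<close> send \<open>m\<close> to single coordinates
  only, and two of these coincide.\<close>
lemma bounded_class_periodic:
  fixes M :: "nat \<Rightarrow> nat \<Rightarrow> int"
  assumes I: "finite I" and nonneg: "\<And>i j. i \<in> I \<Longrightarrow> j \<in> I \<Longrightarrow> 0 \<le> M i j"
    and QI: "Q \<subseteq> I" "Q \<noteq> {}"
    and closed: "\<And>j l. j \<in> Q \<Longrightarrow> l \<in> I \<Longrightarrow> M l j \<noteq> 0 \<Longrightarrow> l \<in> Q"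
    and bounded: "\<And>t l j. l \<in> Q \<Longrightarrow> j \<in> Q \<Longrightarrow> mpow I M t l j \<le> C"
    and nonzero: "\<And>j. j \<in> Q \<Longrightarrow> \<exists>l\<in>I. M l j \<noteq> 0"
  obtains j k where "j \<in> Q" "1 \<le> k" "\<And>l. l \<in> I \<Longrightarrow> mpow I M k l j = (if l = j then 1 else 0)"
proof -
  define P where "P = mpow I M"
  define s where "s t j = (\<Sum>l\<in>I. P t l j)" for t j
  have P0: "0 \<le> P t l j" if "l \<in> I" for t l j
    unfolding P_def using nonneg that by (rule mpow_nonneg)
  have supp: "P t l j = 0" if "j \<in> Q" "l \<in> I" "l \<notin> Q" for t l j
    using closed_class_support[of Q I M j l t] closed that by (auto simp: P_def)
  have s_add: "s (r + t) j = (\<Sum>m\<in>I. s r m * P t m j)" for r t j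
    unfolding s_def P_def by (simp add: mpow_add[OF I] sum_distrib_right) (rule sum.swap)
  have s1: "1 \<le> s 1 m" if m: "m \<in> Q" for m
  proof -
    obtain l where l: "l \<in> I" "M l m \<noteq> 0" using nonzero m by blast
    hence "1 \<le> P 1 l m"
      using nonneg[OF l(1), of m] QI(1) m mpow_1[OF I, of m M l] by (auto simp: P_def)
    also have "\<dots> \<le> s 1 m"
      unfolding s_def using l I P0 by (intro member_le_sum) auto
    finally show ?thesis .
  qed
  have mono: "s t j \<le> s (r + t) j" if j: "j \<in> Q" and r: "\<And>m. m \<in> Q \<Longrightarrow> 1 \<le> s r m" for r t j
    unfolding s_add unfolding s_def[of t]
  proof (rule sum_mono)
    fix m assume m: "m \<in> I"
    show "P t m j \<le> s r m * P t m j"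
    proof (cases "m \<in> Q")
      case True
      thus ?thesis using mult_right_mono[OF r[OF True] P0[OF m, of t j]] by simp
    next
      case False
      thus ?thesis using supp[OF j m] by simp
    qed
  qed
  have s_ge: "1 \<le> s t j" if j: "j \<in> Q" for t j
  proof (induction t)
    case 0
    have "j \<in> I" using j QI by blast
    thus ?case using I by (simp add: s_def P_def)
  next
    case (Suc t)
    thus ?case using mono[OF j, of 1 t] s1 by force
  qed
  have s_le: "s t j \<le> card Q * C" if j: "j \<in> Q" for t j
  proof -
    have "s t j = (\<Sum>l\<in>Q. P t l j)"
      unfolding s_def using I QI(1) supp[OF j] by (intro sum.mono_neutral_right) auto
    also have "\<dots> \<le> (\<Sum>l\<in>Q. C)"
      using bounded j by (intro sum_mono) (auto simp: P_def)
    finally show ?thesis by simp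
  qed
  obtain j where j: "j \<in> Q" using QI(2) by blast
  obtain T where T: "\<And>t. s t j \<le> s T j"
  proof -
    have "nat (s t j) < Suc (nat (card Q * C))" for t
      using nat_mono[OF s_le[OF j, of t]] by simp
    hence "\<exists>T. True \<and> (\<forall>t. True \<longrightarrow> nat (s t j) \<le> nat (s T j))"
      by (intro ex_has_greatest_nat[of "\<lambda>_. True" 0 "\<lambda>t. nat (s t j)"]) auto
    then obtain T where T: "\<forall>t. nat (s t j) \<le> nat (s T j)" by auto
    have "s t j \<le> s T j" for t
      using T[rule_format, of t] s_ge[OF j, of t] by simp
    with that show thesis by blast
  qed
  have "\<exists>m\<in>I. P T m j \<noteq> 0"
  proof (rule ccontr)
    assume "\<not> (\<exists>m\<in>I. P T m j \<noteq> 0)"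
    thus False using s_ge[OF j, of T] by (simp add: s_def)
  qed
  then obtain m where m: "m \<in> I" "P T m j \<noteq> 0" by blast
  hence mQ: "m \<in> Q" using supp[OF j] by blast
  have s_one: "s r m = 1" for r
  proof -
    have "s r m - 1 \<le> (s r m - 1) * P T m j"
      using P0[OF m(1), of T j] m(2) s_ge[OF mQ, of r] by (simp add: mult_le_cancel_left1)
    also have "\<dots> \<le> (\<Sum>m\<in>I. (s r m - 1) * P T m j)"
    proof (rule member_le_sum[OF m(1) _ I])
      fix l assume "l \<in> I - {m}"
      thus "0 \<le> (s r l - 1) * P T l j"
        using P0[of l T j] s_ge[of l r] supp[OF j, of l T] by (cases "l \<in> Q") auto
    qed
    also have "\<dots> = s (r + T) j - s T j"
      unfolding s_add unfolding s_def[of T] by (simp add: left_diff_distrib sum_subtractf)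
    also have "\<dots> \<le> 0" using T by simp
    finally show ?thesis using s_ge[OF mQ, of r] by simp
  qed
  have "\<exists>u\<in>I. \<forall>l\<in>I. P r l m = (if l = u then 1 else 0)" for r
    using nonneg_int_sum_eq_1[OF I, of "\<lambda>l. P r l m"] P0 s_one[of r] unfolding s_def by metis
  then obtain u where u: "\<And>r. u r \<in> I" "\<And>r l. l \<in> I \<Longrightarrow> P r l m = (if l = u r then 1 else 0)"
    by metis
  have "\<not> inj u"
    using u(1) I by (meson finite_imageD finite_subset image_subsetI infinite_UNIV_nat)
  then obtain a b where ab: "a < b" "u a = u b"
    unfolding inj_on_def by (metis linorder_neqE_nat)
  have uQ: "u a \<in> Q"
    using supp[OF mQ u(1), of a a] u(2)[OF u(1), of a a] by auto
  have "P (b - a) l (u a) = (if l = u a then 1 else 0)" if l: "l \<in> I" for l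
  proof -
    have "P (b - a + a) l m = (\<Sum>q\<in>I. P (b - a) l q * P a q m)"
      unfolding P_def by (rule mpow_add[OF I l])
    also have "\<dots> = (\<Sum>q\<in>I. if q = u a then P (b - a) l q else 0)"
      by (intro sum.cong) (auto simp: u(2))
    also have "\<dots> = P (b - a) l (u a)"
      using I u(1) by simp
    finally show ?thesis
      using u(2)[OF l, of b] ab by simp
  qed
  thus thesis
    using uQ ab(1) by (intro that[of "u a" "b - a"]) (auto simp: P_def)
qed

section \<open>Orbits of block triangular matrices\<close>

text \<open>The condition on singletons sets aside the primitive block \<open>[1]\<close>, the only one with bounded powers.\<close>
definition expanding_block :: "nat set \<Rightarrow> (nat \<Rightarrow> nat \<Rightarrow> int) \<Rightarrow> bool" where
  "expanding_block I M \<longleftrightarrow> (\<exists>k\<ge>1. \<forall>i\<in>I. \<forall>j\<in>I. 0 < mpow I M k i j) \<and> (\<forall>l. I = {l} \<longrightarrow> M l l \<notin> {0, 1})"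

definition bounded_block :: "nat set \<Rightarrow> (nat \<Rightarrow> nat \<Rightarrow> int) \<Rightarrow> bool" where
  "bounded_block I M \<longleftrightarrow> (\<exists>C. \<forall>t. \<forall>i\<in>I. \<forall>j\<in>I. mpow I M t i j \<le> C)"

text \<open>If the block has at least two indices, then twice the primitivity exponent works: every index
  lies on such a path from \<open>l\<close> back to \<open>l\<close> at half time. A block with a single index has an entry
  of at least \<open>2\<close>, and the exponent \<open>1\<close> works.\<close>
lemma expanding_block_return:
  assumes I: "finite I" and nonneg: "\<And>i j. i \<in> I \<Longrightarrow> j \<in> I \<Longrightarrow> 0 \<le> M i j"
    and ex: "expanding_block I M" and l: "l \<in> I"
  obtains K where "1 \<le> K" "2 \<le> mpow I M K l l"
proof -
  obtain k where k: "1 \<le> k" "\<And>i j. i \<in> I \<Longrightarrow> j \<in> I \<Longrightarrow> 0 < mpow I M k i j"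
    using ex unfolding expanding_block_def by blast
  show thesis
  proof (cases "I = {l}")
    case True
    obtain k' where "k = Suc k'" using k(1) by (cases k) auto
    hence "M l l \<noteq> 0" using k(2)[OF l l] True by (auto simp: mpow_Suc)
    moreover have "M l l \<noteq> 1" using ex True unfolding expanding_block_def by auto
    ultimately have "2 \<le> M l l" using nonneg[OF l l] by simp
    thus thesis using that[of 1] mpow_1[OF I l, of M l] by simp
  next
    case False
    then obtain l' where l': "l' \<in> I" "l' \<noteq> l" using l by blast
    have "(2::int) = int (card {l, l'})" using l' by simp
    also have "\<dots> \<le> int (card I)" using l l' I by (intro of_nat_mono card_mono) auto
    also have "\<dots> = (\<Sum>m\<in>I. 1 * 1)" by simp
    also have "\<dots> \<le> (\<Sum>m\<in>I. mpow I M k l m * mpow I M k m l)"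
    proof (rule sum_mono)
      fix m assume m: "m \<in> I"
      have "1 \<le> mpow I M k l m" "1 \<le> mpow I M k m l"
        using k(2)[OF l m] k(2)[OF m l] by simp_all
      thus "1 * 1 \<le> mpow I M k l m * mpow I M k m l"
        by (intro mult_mono) auto
    qed
    also have "\<dots> = mpow I M (k + k) l l" by (rule mpow_add[OF I l, symmetric])
    finally show thesis using that[of "k + k"] k(1) by simp
  qed
qed

locale block_triangular =
  fixes n L :: nat and B :: "nat \<Rightarrow> nat set" and M :: "nat \<Rightarrow> nat \<Rightarrow> int"
  assumes nonneg: "\<And>i j. i < n \<Longrightarrow> j < n \<Longrightarrow> 0 \<le> M i j"
    and cover: "(\<Union>p<L. B p) = {..<n}"
    and disjoint: "\<And>p q. p < q \<Longrightarrow> q < L \<Longrightarrow> B p \<inter> B q = {}"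
    and triangular: "\<And>p q i j. p < q \<Longrightarrow> q < L \<Longrightarrow> i \<in> B p \<Longrightarrow> j \<in> B q \<Longrightarrow> M i j = 0"
    and diagonal: "\<And>p. p < L \<Longrightarrow> expanding_block (B p) M \<or> bounded_block (B p) M"
begin

abbreviation A :: "nat \<Rightarrow> nat \<Rightarrow> real" where
  "A i j \<equiv> real_of_int (M i j)"

lemma B_sub: "p < L \<Longrightarrow> B p \<subseteq> {..<n}"
  using cover by blast

lemma B_finite: "p < L \<Longrightarrow> finite (B p)"
  using B_sub finite_subset by blast

lemma diagonal_block_growth:
  assumes p: "p < L" and ij: "i \<in> B p" "j \<in> B p"
  shows "subexponential (\<lambda>t. mpow (B p) A t i j) \<or> (\<exists>r. grows_like (\<lambda>t. mpow (B p) A t i j) 0 r)"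
proof -
  have nn: "0 \<le> M i j" if "i \<in> B p" "j \<in> B p" for i j
    using nonneg that B_sub[OF p] by blast
  from diagonal[OF p] show ?thesis
  proof
    assume "expanding_block (B p) M"
    then obtain k where k: "1 \<le> k" "\<And>i j. i \<in> B p \<Longrightarrow> j \<in> B p \<Longrightarrow> 0 < mpow (B p) M k i j"
      unfolding expanding_block_def by blast
    interpret primitive_matrix "B p" A k
      using k ij nn B_finite[OF p] by unfold_locales (auto simp: mpow_of_int)
    show ?thesis by (rule block_growth[OF ij])
  next
    assume "bounded_block (B p) M"
    then obtain C where C: "\<And>t. mpow (B p) M t i j \<le> C"
      using ij unfolding bounded_block_def by blast
    have "subexponential (\<lambda>t. mpow (B p) A t i j)"
    proof (rule bounded_subexponential)
      show "0 \<le> mpow (B p) A t i j" for t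
        using nn ij by (intro mpow_nonneg) auto
      show "mpow (B p) A t i j \<le> real_of_int C" for t
        using C[of t] by (simp add: mpow_of_int)
    qed
    thus ?thesis ..
  qed
qed

lemma orbit_nonneg:
  assumes x: "\<And>t i. i < n \<Longrightarrow> x (Suc t) i = (\<Sum>j<n. A i j * x t j)"
    and x0: "\<And>i. i < n \<Longrightarrow> 0 \<le> x 0 i" and i: "i < n"
  shows "0 \<le> x t i"
  using i
proof (induction t arbitrary: i)
  case (Suc t)
  thus ?case unfolding x[OF Suc.prems] using nonneg by (intro sum_nonneg mult_nonneg_nonneg) auto
qed (rule x0)

text \<open>Induction over the blocks: the coordinates in earlier blocks act as a source of regular growth on the
  coordinates of the block.\<close>
lemma orbit_regular:
  assumes x: "\<And>t i. i < n \<Longrightarrow> x (Suc t) i = (\<Sum>j<n. A i j * x t j)"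
    and x0: "\<And>i. i < n \<Longrightarrow> 0 \<le> x 0 i" and i: "i < n"
  shows "regular_growth (\<lambda>t. x t i)"
proof -
  have "\<forall>i\<in>B p. regular_growth (\<lambda>t. x t i)" if "p < L" for p
    using that
  proof (induction p rule: less_induct)
    case (less p)
    define E where "E = (\<Union>q<p. B q)"
    define b where "b t i = (\<Sum>j\<in>E. A i j * x t j)" for t i
    have E: "E \<subseteq> {..<n}"
      unfolding E_def using less.prems by (intro UN_least B_sub) auto
    have EB: "E \<inter> B p = {}" using disjoint less.prems unfolding E_def by blast
    have step: "x (Suc t) i = (\<Sum>j\<in>B p. A i j * x t j) + b t i" if i: "i \<in> B p" for t i
    proof -
      have "M i j = 0" if "j < n" "j \<notin> E" "j \<notin> B p" for j
      proof -
        from that(1) cover obtain q where q: "q < L" "j \<in> B q" by blast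
        with that have "p < q" unfolding E_def by (metis UN_I lessThan_iff linorder_neqE_nat)
        thus ?thesis using triangular i q by blast
      qed
      hence "(\<Sum>j<n. A i j * x t j) = (\<Sum>j\<in>B p \<union> E. A i j * x t j)"
        using E B_sub[OF less.prems] by (intro sum.mono_neutral_right) auto
      also have "\<dots> = (\<Sum>j\<in>B p. A i j * x t j) + b t i"
        unfolding b_def using EB E B_finite[OF less.prems]
        by (intro sum.union_disjoint) (auto intro: finite_subset)
      finally show ?thesis
        using x[of i t] i B_sub[OF less.prems] by auto
    qed
    have b_reg: "regular_growth (\<lambda>t. b t i)" if i: "i \<in> B p" for i
      unfolding b_def
    proof (rule regular_sum)
      fix j assume j: "j \<in> E"
      then obtain q where "q < p" "j \<in> B q" unfolding E_def by blast
      hence "regular_growth (\<lambda>t. x t j)" using less by simp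
      moreover have "0 \<le> A i j" using nonneg i j E B_sub[OF less.prems] by auto
      ultimately show "regular_growth (\<lambda>t. A i j * x t j)" by (rule regular_cmult)
    qed
    show ?case
    proof
      fix i assume i: "i \<in> B p"
      have "regular_growth (\<lambda>t. \<Sum>j\<in>B p. conv (\<lambda>s. mpow (B p) A s i j) (\<lambda>s. case s of 0 \<Rightarrow> x 0 j | Suc s \<Rightarrow> b s j) t)"
      proof (rule regular_sum)
        fix j assume j: "j \<in> B p"
        have "regular_growth (\<lambda>s. case s of 0 \<Rightarrow> x 0 j | Suc s \<Rightarrow> b s j)"
        proof (rule regular_unshift)
          have "j < n" using j B_sub[OF less.prems] by blast
          thus "0 \<le> (case 0 of 0 \<Rightarrow> x 0 j | Suc s \<Rightarrow> b s j)" using x0 by simp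
          show "regular_growth (\<lambda>t. case Suc t of 0 \<Rightarrow> x 0 j | Suc s \<Rightarrow> b s j)"
            using b_reg[OF j] by simp
        qed
        moreover have "0 \<le> mpow (B p) A s i j" for s
          using i nonneg B_sub[OF less.prems] by (intro mpow_nonneg) auto
        moreover obtain r where "subexponential (\<lambda>t. mpow (B p) A t i j) \<or> grows_like (\<lambda>t. mpow (B p) A t i j) 0 r"
          using diagonal_block_growth[OF less.prems i j] by blast
        ultimately show "regular_growth (conv (\<lambda>s. mpow (B p) A s i j) (\<lambda>s. case s of 0 \<Rightarrow> x 0 j | Suc s \<Rightarrow> b s j))"
          by (intro regular_conv)
      qed
      thus "regular_growth (\<lambda>t. x t i)"
        using variation_of_constants[of "B p" x A b i, OF B_finite[OF less.prems] step i] by simp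
    qed
  qed
  thus ?thesis using cover i by blast
qed

text \<open>Otherwise let \<open>q\<close> be the last block reached from \<open>i\<close>. The reached coordinates in this block
  cannot be left any more, and as the block is power bounded, \<open>bounded_class_periodic\<close> yields a periodic
  coordinate vector.\<close>
lemma reaches_expanding_block:
  assumes nonzero: "\<And>j. j < n \<Longrightarrow> \<exists>i<n. M i j \<noteq> 0"
    and aperiodic: "\<And>j k. j < n \<Longrightarrow> 1 \<le> k \<Longrightarrow> \<exists>i<n. mpow {..<n} M k i j \<noteq> (if i = j then 1 else 0)"
    and i: "i < n"
  obtains p l t where "p < L" "expanding_block (B p) M" "l \<in> B p" "0 < mpow {..<n} M t l i"
proof (rule ccontr)
  assume contr: "\<not> thesis"
  define P where "P = mpow {..<n} M"
  define R where "R = {j\<in>{..<n}. \<exists>t. 0 < P t j i}"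
  define H where "H = {p\<in>{..<L}. B p \<inter> R \<noteq> {}}"
  have "0 < P 0 i i" by (simp add: P_def)
  hence "i \<in> R" unfolding R_def using i by blast
  then obtain p where "p < L" "i \<in> B p \<inter> R" using cover i by blast
  hence H: "finite H" "H \<noteq> {}" unfolding H_def by auto
  define q where "q = Max H"
  have q: "q < L" "B q \<inter> R \<noteq> {}" using Max_in[OF H] unfolding q_def H_def by auto
  have q_max: "p \<le> q" if "p < L" "j \<in> B p" "j \<in> R" for p j
    unfolding q_def using that H by (intro Max_ge) (auto simp: H_def)
  define Q where "Q = B q \<inter> R"
  have closed: "l \<in> Q" if j: "j \<in> Q" and l: "l \<in> {..<n}" and lj: "M l j \<noteq> 0" for j l
  proof -
    from j obtain t where t: "0 < P t j i" and jn: "j < n" unfolding Q_def R_def by blast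
    have "0 < M l j" using nonneg[of l j] l jn lj by simp
    hence "0 < M l j * P t j i" using t by simp
    also have "\<dots> \<le> P (Suc t) l i"
      unfolding P_def mpow_Suc using l jn nonneg
      by (intro member_le_sum) (auto intro!: mult_nonneg_nonneg mpow_nonneg)
    finally have lR: "l \<in> R" using l unfolding R_def by blast
    obtain q' where q': "q' < L" "l \<in> B q'" using l cover by blast
    have "\<not> q' < q" using triangular[of q' q l j] q(1) q' j lj unfolding Q_def by blast
    with q_max[OF q' lR] have "q' = q" by simp
    thus ?thesis using q' lR unfolding Q_def by simp
  qed
  have "\<not> expanding_block (B q) M"
  proof
    assume "expanding_block (B q) M"
    moreover obtain l t where "l \<in> B q" "0 < P t l i" using q(2) unfolding R_def by blast
    ultimately show False using that[of q l t] q(1) contr unfolding P_def by blast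
  qed
  with diagonal[OF q(1)] obtain C where C: "\<And>t i j. i \<in> B q \<Longrightarrow> j \<in> B q \<Longrightarrow> mpow (B q) M t i j \<le> C"
    unfolding bounded_block_def by blast
  have restrict: "mpow {..<n} M t l j = mpow (B q) M t l j" if "j \<in> Q" "l \<in> B q" for t l j
    using that(2)
  proof (induction t arbitrary: l)
    case (Suc t)
    have "mpow {..<n} M t m j = 0" if "m < n" "m \<notin> B q" for m
      using closed_class_support[of Q "{..<n}" M j m t] closed \<open>j \<in> Q\<close> that unfolding Q_def by blast
    hence "(\<Sum>m<n. M l m * mpow {..<n} M t m j) = (\<Sum>m\<in>B q. M l m * mpow {..<n} M t m j)"
      using B_sub[OF q(1)] by (intro sum.mono_neutral_right) auto
    thus ?case using Suc.IH by (simp add: mpow_Suc)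
  qed simp
  obtain j k where jk: "j \<in> Q" "1 \<le> k" "\<And>l. l \<in> {..<n} \<Longrightarrow> mpow {..<n} M k l j = (if l = j then 1 else 0)"
  proof (rule bounded_class_periodic[of "{..<n}" M Q C])
    show "Q \<subseteq> {..<n}" "Q \<noteq> {}" using q(2) unfolding Q_def R_def by auto
    show "mpow {..<n} M t l j \<le> C" if "l \<in> Q" "j \<in> Q" for t l j
      using that restrict[of j l t] C[of l j t] unfolding Q_def by simp
    show "\<exists>l\<in>{..<n}. M l j \<noteq> 0" if "j \<in> Q" for j
      using nonzero[of j] that unfolding Q_def R_def by auto
  qed (use nonneg closed in auto)
  have "j < n" using jk(1) unfolding Q_def R_def by blast
  thus False using aperiodic[OF _ jk(2)] jk(3) by blast
qed

lemma exponential_growth: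
  assumes nonzero: "\<And>j. j < n \<Longrightarrow> \<exists>i<n. M i j \<noteq> 0"
    and aperiodic: "\<And>j k. j < n \<Longrightarrow> 1 \<le> k \<Longrightarrow> \<exists>i<n. mpow {..<n} M k i j \<noteq> (if i = j then 1 else 0)"
    and i: "i < n"
  obtains K T l where "1 \<le> K" "l < n" "\<forall>m. 2 ^ m \<le> mpow {..<n} M (K * m + T) l i"
proof -
  obtain p l T where p: "p < L" "expanding_block (B p) M" "l \<in> B p" "0 < mpow {..<n} M T l i"
    by (rule reaches_expanding_block[OF assms])
  have ln: "l < n" using p B_sub by blast
  have nn: "0 \<le> M i j" if "i \<in> B p" "j \<in> B p" for i j
    using nonneg that B_sub[OF p(1)] by blast
  obtain K where K: "1 \<le> K" "2 \<le> mpow (B p) M K l l"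
    by (rule expanding_block_return[OF B_finite[OF p(1)] nn p(2,3)])
  have "2 ^ m \<le> mpow {..<n} M (K * m + T) l i" for m
  proof -
    have "2 ^ m \<le> mpow (B p) M K l l ^ m" using K(2) by (intro power_mono) auto
    also have "\<dots> \<le> mpow (B p) M (K * m) l l"
      by (rule mpow_power_le[OF B_finite[OF p(1)] nn p(3)])
    also have "\<dots> \<le> mpow {..<n} M (K * m) l l"
      using B_sub[OF p(1)] nonneg p(3) by (intro mpow_mono_subset) auto
    finally have "2 ^ m \<le> mpow {..<n} M (K * m) l l" .
    moreover have "0 \<le> mpow {..<n} M (K * m) l l"
      using nonneg ln by (intro mpow_nonneg) auto
    ultimately have "2 ^ m * 1 \<le> mpow {..<n} M (K * m) l l * mpow {..<n} M T l i"
      using p(4) by (intro mult_mono) auto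
    also have "\<dots> \<le> mpow {..<n} M (K * m + T) l i"
      using nonneg ln by (intro mpow_mult_le_add) auto
    finally show ?thesis by simp
  qed
  thus thesis using that K(1) ln by blast
qed

lemma exponential_not_subexponential:
  assumes "subexponential f" "1 \<le> K" "0 < c" "\<And>m. c * 2 ^ m \<le> f (K * m + T)"
  shows False
proof -
  \<comment> \<open>Along the times \<open>K * m + T\<close> the sequence keeps up with \<open>r\<close> to the power of the time.\<close>
  define r where "r = root K 2"
  have r: "1 < r" "r ^ K = 2" using assms(2) by (simp_all add: r_def)
  have "strict_mono (\<lambda>m. K * m + T)" using assms(2) by (simp add: strict_mono_def)
  moreover have "(\<lambda>t. f t / polyexp 0 r t) \<longlonglongrightarrow> 0"
    using assms(1) r(1) by (simp add: subexponential_def)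
  ultimately have "(\<lambda>m. f (K * m + T) / polyexp 0 r (K * m + T)) \<longlonglongrightarrow> 0"
    using LIMSEQ_subseq_LIMSEQ by (fastforce simp: o_def)
  moreover have "c / r ^ T \<le> f (K * m + T) / polyexp 0 r (K * m + T)" for m
  proof -
    have "polyexp 0 r (K * m + T) = 2 ^ m * r ^ T"
      by (simp add: polyexp_0 power_add power_mult r(2))
    moreover have "c / r ^ T = c * 2 ^ m / (2 ^ m * r ^ T)" by simp
    ultimately show ?thesis
      using assms(4)[of m] r(1) by (simp only:) (intro divide_right_mono, auto)
  qed
  ultimately have "c / r ^ T \<le> 0" by (intro LIMSEQ_le_const) auto
  moreover have "0 < c / r ^ T" using assms(3) r(1) by simp
  ultimately show False by simp
qed

lemma orbit_mpow:
  assumes x: "\<And>t i. i < n \<Longrightarrow> x (Suc t) i = (\<Sum>j<n. A i j * x t j)" and i: "i < n"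
  shows "x t i = (\<Sum>j<n. mpow {..<n} A t i j * x 0 j)"
  using i
proof (induction t arbitrary: i)
  case 0
  have "(\<Sum>j<n. mpow {..<n} A 0 i j * x 0 j) = (\<Sum>j<n. if j = i then x 0 j else 0)"
    by (intro sum.cong) auto
  thus ?case using 0 by simp
next
  case (Suc t)
  have "x (Suc t) i = (\<Sum>l<n. \<Sum>j<n. A i l * mpow {..<n} A t l j * x 0 j)"
    unfolding x[OF Suc.prems] using Suc.IH by (simp add: sum_distrib_left mult.assoc)
  also have "\<dots> = (\<Sum>j<n. mpow {..<n} A (Suc t) i j * x 0 j)"
    by (subst sum.swap) (simp add: mpow_Suc sum_distrib_right)
  finally show ?case .
qed

text \<open>The coordinate sum \<open>S\<close> grows exponentially, hence like some \<open>polyexp k r\<close>. Every coordinate is at most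
  \<open>S\<close>, so by \<open>regular_compare\<close> it has a limit relative to this scale.\<close>
theorem limit_direction:
  assumes nonzero: "\<And>j. j < n \<Longrightarrow> \<exists>i<n. M i j \<noteq> 0"
    and aperiodic: "\<And>j k. j < n \<Longrightarrow> 1 \<le> k \<Longrightarrow> \<exists>i<n. mpow {..<n} M k i j \<noteq> (if i = j then 1 else 0)"
    and x: "\<And>t i. i < n \<Longrightarrow> x (Suc t) i = (\<Sum>j<n. A i j * x t j)"
    and x0: "\<And>i. i < n \<Longrightarrow> 0 \<le> x 0 i" and x0_pos: "\<exists>i<n. 0 < x 0 i"
  obtains w r where "\<forall>i<n. (\<lambda>t. x t i / (\<Sum>j<n. x t j)) \<longlonglongrightarrow> w i"
    "(\<Sum>i<n. w i) = 1" "\<forall>i<n. (\<Sum>j<n. A i j * w j) = r * w i"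
proof -
  define S where "S t = (\<Sum>j<n. x t j)" for t
  note x_nonneg = orbit_nonneg[of x, OF x x0]
  have x_le_S: "x t i \<le> S t" if "i < n" for t i
    unfolding S_def using that x_nonneg by (intro member_le_sum) auto
  have x_regular: "regular_growth (\<lambda>t. x t i)" if "i < n" for i
    by (rule orbit_regular[of x, OF x x0 that])
  have "regular_growth S"
    unfolding S_def using x_regular by (intro regular_sum) auto
  moreover have "\<not> subexponential S"
  proof
    assume sub: "subexponential S"
    obtain i where i: "i < n" "0 < x 0 i" using x0_pos by blast
    have "\<exists>K T l. 1 \<le> K \<and> l < n \<and> (\<forall>m. 2 ^ m \<le> mpow {..<n} M (K * m + T) l i)"
      by (rule exponential_growth[OF nonzero aperiodic i(1)]) blast+
    then obtain K T l where K: "1 \<le> K" "l < n" "\<forall>m. 2 ^ m \<le> mpow {..<n} M (K * m + T) l i"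
      by blast
    have "x 0 i * 2 ^ m \<le> S (K * m + T)" for m
    proof -
      have "real_of_int (2 ^ m) \<le> real_of_int (mpow {..<n} M (K * m + T) l i)"
        using K(3) by (simp only: of_int_le_iff)
      hence "2 ^ m \<le> mpow {..<n} A (K * m + T) l i"
        by (simp add: mpow_of_int)
      hence "x 0 i * 2 ^ m \<le> mpow {..<n} A (K * m + T) l i * x 0 i"
        using i(2) by (simp add: mult.commute mult_left_mono)
      also have "\<dots> \<le> (\<Sum>j<n. mpow {..<n} A (K * m + T) l j * x 0 j)"
        using i(1) K(2) nonneg x0 by (intro member_le_sum) (auto intro!: mult_nonneg_nonneg mpow_nonneg)
      also have "\<dots> = x (K * m + T) l"
        by (rule orbit_mpow[of x, OF x K(2), symmetric])
      also have "\<dots> \<le> S (K * m + T)" by (rule x_le_S[OF K(2)])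
      finally show ?thesis .
    qed
    thus False using exponential_not_subexponential[OF sub K(1) i(2)] by blast
  qed
  ultimately obtain k r c where r: "1 < r" and c: "0 < c" "(\<lambda>t. S t / polyexp k r t) \<longlonglongrightarrow> c"
    by (auto simp: regular_growth_def grows_like_def)
  have r0: "0 < r" using r by simp
  note pos = polyexp_pos[OF r0]
  have "\<exists>d. (\<lambda>t. x t i / polyexp k r t) \<longlonglongrightarrow> d" if i: "i < n" for i
    using x_regular[OF i] r
  proof (cases rule: regular_compare[where l = k])
    case (1 d)
    thus ?thesis by blast
  next
    case (2 k' r' d)
    have nz: "polyexp k r t \<noteq> 0" for t using pos[of k t] by simp
    have "(\<lambda>t. S t / polyexp k' r' t) \<longlonglongrightarrow> 0"
      by (rule ratio_tendsto_0_trans[OF c(2) 2(4) nz])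
    moreover have "x t i / polyexp k' r' t \<le> S t / polyexp k' r' t" for t
      using x_le_S[OF i, of t] polyexp_pos[of r' k' t] 2(1) by (intro divide_right_mono) auto
    ultimately have "d \<le> 0" using 2(3) by (intro LIMSEQ_le) auto
    thus ?thesis using 2(2) by simp
  qed
  then obtain d where d: "\<And>i. i < n \<Longrightarrow> (\<lambda>t. x t i / polyexp k r t) \<longlonglongrightarrow> d i" by metis
  define w where "w i = d i / c" for i
  have lim: "(\<lambda>t. x t i / S t) \<longlonglongrightarrow> w i" if i: "i < n" for i
  proof -
    have "(\<lambda>t. x t i / polyexp k r t / (S t / polyexp k r t)) \<longlonglongrightarrow> w i"
      unfolding w_def using c by (intro tendsto_divide d i) auto
    moreover have "x t i / polyexp k r t / (S t / polyexp k r t) = x t i / S t" for t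
      using pos[of k t] by simp
    ultimately show ?thesis by (simp only:)
  qed
  have w_sum: "(\<Sum>i<n. w i) = 1"
  proof -
    have "(\<lambda>t. \<Sum>i<n. x t i / polyexp k r t) \<longlonglongrightarrow> (\<Sum>i<n. d i)"
      using d by (intro tendsto_sum) auto
    hence "(\<lambda>t. S t / polyexp k r t) \<longlonglongrightarrow> (\<Sum>i<n. d i)"
      by (simp add: S_def sum_divide_distrib)
    hence "(\<Sum>i<n. d i) = c" using c(2) LIMSEQ_unique by blast
    thus ?thesis using c(1) by (simp add: w_def flip: sum_divide_distrib)
  qed
  \<comment> \<open>Both sides are limits of \<open>x (Suc t) i / S t\<close>.\<close>
  have "(\<Sum>j<n. A i j * w j) = r * w i" if i: "i < n" for i
  proof (rule LIMSEQ_unique)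
    have "(\<lambda>t. \<Sum>j<n. A i j * (x t j / S t)) \<longlonglongrightarrow> (\<Sum>j<n. A i j * w j)"
      using lim by (intro tendsto_sum tendsto_mult tendsto_const) auto
    thus "(\<lambda>t. x (Suc t) i / S t) \<longlonglongrightarrow> (\<Sum>j<n. A i j * w j)"
      by (simp add: x[OF i] sum_divide_distrib)
    have "(\<lambda>t. x (Suc t) i / polyexp k r (Suc t) * (polyexp k r (Suc t) / polyexp k r t) / (S t / polyexp k r t))
        \<longlonglongrightarrow> d i * r / c"
      using c by (intro tendsto_divide tendsto_mult polyexp_Suc_ratio r0 LIMSEQ_Suc[OF d[OF i]]) auto
    moreover have "x (Suc t) i / polyexp k r (Suc t) * (polyexp k r (Suc t) / polyexp k r t) / (S t / polyexp k r t)
        = x (Suc t) i / S t" for t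
      using pos[of k t] pos[of k "Suc t"] by simp
    moreover have "d i * r / c = r * w i" by (simp add: w_def)
    ultimately show "(\<lambda>t. x (Suc t) i / S t) \<longlonglongrightarrow> r * w i" by (simp only:)
  qed
  with lim w_sum show thesis unfolding S_def by (intro that[of w r]) auto
qed

end

section \<open>Translation from matrices and their blocks\<close>

lemma mpow_reindex:
  assumes "inj_on h I" "i \<in> I" "j \<in> I"
  shows "mpow (h ` I) A t (h i) (h j) = mpow I (\<lambda>a b. A (h a) (h b)) t i j"
  using assms(2)
proof (induction t arbitrary: i)
  case 0
  thus ?case using inj_onD[OF assms(1), of i j] assms(3) by auto
next
  case (Suc t)
  thus ?case by (simp add: mpow_Suc sum.reindex[OF assms(1)])
qed

lemma mpow_cong:
  assumes "\<And>i j. i \<in> I \<Longrightarrow> j \<in> I \<Longrightarrow> A i j = A' i j" "i \<in> I"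
  shows "mpow I A t i j = mpow I A' t i j"
  using assms(2) by (induction t arbitrary: i) (auto simp: mpow_Suc assms(1) intro!: sum.cong)

lemma mult_mat_vec_index_sum:
  assumes "N \<in> carrier_mat n n" "u \<in> carrier_vec n" "i < n"
  shows "(N *\<^sub>v u) $ i = (\<Sum>j<n. N $$ (i, j) * u $ j)"
  using assms by (auto simp: scalar_prod_def lessThan_atLeast0 intro!: sum.cong)

lemma pow_mat_index_mpow:
  fixes N :: "'a::comm_semiring_1 mat"
  assumes N: "N \<in> carrier_mat n n" and i: "i < n" and j: "j < n"
  shows "(N ^\<^sub>m t) $$ (i, j) = mpow {..<n} (\<lambda>i j. N $$ (i, j)) t i j"
  using j
proof (induction t arbitrary: j)
  case 0
  thus ?case using N i by simp
next
  case (Suc t)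
  have "N ^\<^sub>m t \<in> carrier_mat n n" using N by (rule pow_carrier_mat)
  hence "(N ^\<^sub>m Suc t) $$ (i, j) = (\<Sum>l<n. (N ^\<^sub>m t) $$ (i, l) * N $$ (l, j))"
    using N i Suc.prems by (auto simp: scalar_prod_def lessThan_atLeast0 intro!: sum.cong)
  also have "\<dots> = mpow {..<n} (\<lambda>i j. N $$ (i, j)) (Suc t) i j"
    using Suc i by (subst mpow_Suc_right) auto
  finally show ?case .
qed

lemma mult_unit_vec_index:
  fixes N :: "int mat"
  assumes "N \<in> carrier_mat n n" "i < n" "j < n"
  shows "(N *\<^sub>v unit_vec n j) $ i = N $$ (i, j)"
proof -
  have "(N *\<^sub>v unit_vec n j) $ i = (\<Sum>l<n. N $$ (i, l) * unit_vec n j $ l)"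
    using assms by (intro mult_mat_vec_index_sum) auto
  also have "\<dots> = (\<Sum>l<n. if l = j then N $$ (i, l) else 0)"
    using assms(3) by (intro sum.cong) auto
  finally show ?thesis using assms(3) by simp
qed

lemma sum_list_take_mono: "p \<le> q \<Longrightarrow> sum_list (take p ds) \<le> sum_list (take q (ds :: nat list))"
  by (metis le_add1 le_add_diff_inverse sum_list_append take_add)

lemma block_indices_eq:
  "p < length ds \<Longrightarrow> block_indices ds p = {sum_list (take p ds)..<sum_list (take p ds) + ds ! p}"
  by (simp add: block_indices_def take_Suc_conv_app_nth)

lemma UN_block_indices: "(\<Union>p<k. block_indices ds p) = {..<sum_list (take k ds)}"
proof (induction k)
  case (Suc k)
  have "(\<Union>p<Suc k. block_indices ds p) = block_indices ds k \<union> (\<Union>p<k. block_indices ds p)"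
    by (simp add: lessThan_Suc)
  also have "\<dots> = {..<sum_list (take (Suc k) ds)}"
    unfolding Suc.IH unfolding block_indices_def using sum_list_take_mono[of k "Suc k" ds] by auto
  finally show ?case .
qed simp

lemma block_indices_disjoint: "p < q \<Longrightarrow> block_indices ds p \<inter> block_indices ds q = {}"
  using sum_list_take_mono[of "Suc p" q ds] by (auto simp: block_indices_def)

context
  fixes n :: nat and ds :: "nat list" and M :: "int mat"
  assumes part: "block_partition n ds" and M: "M \<in> carrier_mat n n"
begin

lemma block_indices_subset: "p < length ds \<Longrightarrow> block_indices ds p \<subseteq> {..<n}"
  using UN_block_indices[of ds "length ds"] part by (auto simp: block_partition_def)

lemma block_carrier:
  assumes "p < length ds" "q < length ds"
  shows "block ds M p q \<in> carrier_mat (ds ! p) (ds ! q)"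
proof -
  have "card {i. i < n \<and> i \<in> block_indices ds p} = ds ! p" if p: "p < length ds" for p
  proof -
    have "{i. i < n \<and> i \<in> block_indices ds p} = block_indices ds p"
      using block_indices_subset[OF p] by auto
    thus ?thesis using p by (simp add: block_indices_eq)
  qed
  thus ?thesis
    using assms M by (intro carrier_matI) (simp_all add: block_def dim_submatrix)
qed

lemma block_index:
  assumes p: "p < length ds" "a < ds ! p" and q: "q < length ds" "b < ds ! q"
  shows "block ds M p q $$ (a, b) = M $$ (sum_list (take p ds) + a, sum_list (take q ds) + b)"
proof -
  have card: "card {x \<in> block_indices ds p. x < sum_list (take p ds) + a} = a"
    if "p < length ds" "a < ds ! p" for p a
  proof -
    have "{x \<in> block_indices ds p. x < sum_list (take p ds) + a}
        = {sum_list (take p ds)..<sum_list (take p ds) + a}"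
      using that by (auto simp: block_indices_eq)
    thus ?thesis by simp
  qed
  have mem: "sum_list (take p ds) + a \<in> block_indices ds p" if "p < length ds" "a < ds ! p" for p a
    using that by (simp add: block_indices_eq)
  have "submatrix M (block_indices ds p) (block_indices ds q)
      $$ (card {x \<in> block_indices ds p. x < sum_list (take p ds) + a},
          card {x \<in> block_indices ds q. x < sum_list (take q ds) + b})
      = M $$ (sum_list (take p ds) + a, sum_list (take q ds) + b)"
    using mem[OF p] mem[OF q] block_indices_subset[OF p(1)] block_indices_subset[OF q(1)] M
    by (intro submatrix_index_card) auto
  thus ?thesis by (simp add: card p q block_def)
qed

lemma block_indicesE:
  assumes "p < length ds" "i \<in> block_indices ds p"
  obtains a where "a < ds ! p" "i = sum_list (take p ds) + a"
proof -
  have "i - sum_list (take p ds) < ds ! p" "i = sum_list (take p ds) + (i - sum_list (take p ds))"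
    using assms by (auto simp: block_indices_eq)
  thus thesis by (rule that)
qed

lemma block_pow_index:
  assumes p: "p < length ds" and ab: "a < ds ! p" "b < ds ! p"
  shows "(block ds M p p ^\<^sub>m t) $$ (a, b)
    = mpow (block_indices ds p) (\<lambda>i j. M $$ (i, j)) t (sum_list (take p ds) + a) (sum_list (take p ds) + b)"
proof -
  let ?o = "sum_list (take p ds)"
  have "(block ds M p p ^\<^sub>m t) $$ (a, b) = mpow {..<ds ! p} (\<lambda>a b. block ds M p p $$ (a, b)) t a b"
    by (rule pow_mat_index_mpow[OF block_carrier[OF p p] ab])
  also have "\<dots> = mpow {..<ds ! p} (\<lambda>a b. M $$ (?o + a, ?o + b)) t a b"
    using ab p by (intro mpow_cong) (auto simp: block_index)
  also have "\<dots> = mpow ((+) ?o ` {..<ds ! p}) (\<lambda>i j. M $$ (i, j)) t (?o + a) (?o + b)"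
    using ab by (intro mpow_reindex[symmetric]) auto
  also have "(+) ?o ` {..<ds ! p} = block_indices ds p"
    using p by (simp add: block_indices_eq lessThan_atLeast0 add.commute)
  finally show ?thesis .
qed

lemma primitive_block_expanding:
  assumes p: "p < length ds" and prim: "primitive_block (block ds M p p)"
  shows "expanding_block (block_indices ds p) (\<lambda>i j. M $$ (i, j))"
proof -
  have dim: "dim_row (block ds M p p) = ds ! p" "dim_col (block ds M p p) = ds ! p"
    using block_carrier[OF p p] by auto
  obtain k where k: "k \<ge> 1" "\<And>a b. a < ds ! p \<Longrightarrow> b < ds ! p \<Longrightarrow> 0 < (block ds M p p ^\<^sub>m k) $$ (a, b)"
    using prim unfolding primitive_block_def primitive_mat_def dim by blast
  have "0 < mpow (block_indices ds p) (\<lambda>i j. M $$ (i, j)) k i j"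
    if i: "i \<in> block_indices ds p" and j: "j \<in> block_indices ds p" for i j
  proof -
    obtain a b where ab: "a < ds ! p" "i = sum_list (take p ds) + a" "b < ds ! p" "j = sum_list (take p ds) + b"
      using block_indicesE[OF p i] block_indicesE[OF p j] by metis
    thus ?thesis using k(2)[OF ab(1,3)] by (simp add: block_pow_index[OF p])
  qed
  moreover have "M $$ (l, l) \<notin> {0, 1}" if l: "block_indices ds p = {l}" for l
  proof -
    have "card (block_indices ds p) = 1" using l by simp
    hence d: "ds ! p = 1" using p by (simp add: block_indices_eq)
    hence "l = sum_list (take p ds)" using l p by (auto simp: block_indices_eq)
    hence "block ds M p p $$ (0, 0) = M $$ (l, l)"
      using block_index[OF p _ p, of 0 0] d by simp
    thus ?thesis using prim dim d by (auto simp: primitive_block_def)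
  qed
  ultimately show ?thesis using k(1) unfolding expanding_block_def by blast
qed

lemma PB_block_bounded:
  assumes p: "p < length ds" and pb: "PB_block (block ds M p p)"
  shows "bounded_block (block_indices ds p) (\<lambda>i j. M $$ (i, j))"
proof -
  have dim: "dim_row (block ds M p p) = ds ! p" "dim_col (block ds M p p) = ds ! p"
    using block_carrier[OF p p] by auto
  obtain C where C: "\<And>t a b. t \<ge> 1 \<Longrightarrow> a < ds ! p \<Longrightarrow> b < ds ! p \<Longrightarrow> (block ds M p p ^\<^sub>m t) $$ (a, b) \<le> C"
    using pb unfolding PB_block_def power_bounded_mat_def dim by blast
  \<comment> \<open>The zeroth power is the identity matrix, hence the \<open>1\<close>.\<close>
  have "mpow (block_indices ds p) (\<lambda>i j. M $$ (i, j)) t i j \<le> max C 1"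
    if i: "i \<in> block_indices ds p" and j: "j \<in> block_indices ds p" for t i j
  proof (cases "t = 0")
    case False
    obtain a b where ab: "a < ds ! p" "i = sum_list (take p ds) + a" "b < ds ! p" "j = sum_list (take p ds) + b"
      using block_indicesE[OF p i] block_indicesE[OF p j] by metis
    thus ?thesis using C[of t, OF _ ab(1,3)] False by (simp add: block_pow_index[OF p] le_max_iff_disj)
  qed (simp add: le_max_iff_disj)
  thus ?thesis unfolding bounded_block_def by blast
qed

end

lemma PB_Frobenius_block_triangular:
  assumes M: "M \<in> carrier_mat n n" and nonneg: "0\<^sub>m n n \<le> M" and PB: "PB_Frobenius_form M"
  obtains L B where "block_triangular n L B (\<lambda>i j. M $$ (i, j))"
proof -
  obtain ds where part: "block_partition n ds"
    and low: "\<And>p q. q < length ds \<Longrightarrow> p < q \<Longrightarrow> block ds M p q = 0\<^sub>m (ds ! p) (ds ! q)"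
    and diag: "\<And>p. p < length ds \<Longrightarrow> primitive_block (block ds M p p) \<or> PB_block (block ds M p p)"
    using PB M unfolding PB_Frobenius_form_def by auto
  have "block_triangular n (length ds) (block_indices ds) (\<lambda>i j. M $$ (i, j))"
  proof
    show "0 \<le> M $$ (i, j)" if "i < n" "j < n" for i j
      using nonneg M that by (auto simp: less_eq_mat_def)
    show "(\<Union>p<length ds. block_indices ds p) = {..<n}"
      using part by (simp add: UN_block_indices block_partition_def)
    show "M $$ (i, j) = 0"
      if pq: "p < q" "q < length ds" and i: "i \<in> block_indices ds p" and j: "j \<in> block_indices ds q" for p q i j
    proof -
      have p: "p < length ds" using pq by simp
      obtain a where a: "a < ds ! p" "i = sum_list (take p ds) + a"
        using block_indicesE[OF part M p i] .
      obtain b where b: "b < ds ! q" "j = sum_list (take q ds) + b"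
        using block_indicesE[OF part M pq(2) j] .
      have "M $$ (i, j) = block ds M p q $$ (a, b)"
        using block_index[OF part M p a(1) pq(2) b(1)] a b by simp
      thus ?thesis using low[OF pq(2,1)] a b by simp
    qed
    show "expanding_block (block_indices ds p) (\<lambda>i j. M $$ (i, j)) \<or> bounded_block (block_indices ds p) (\<lambda>i j. M $$ (i, j))"
      if "p < length ds" for p
      using diag[OF that] primitive_block_expanding[OF part M that] PB_block_bounded[OF part M that] by blast
  qed (rule block_indices_disjoint)
  thus thesis by (rule that)
qed

theorem theorem1p1:
  fixes n :: nat and M :: "int mat" and v :: "real vec"
  assumes "M \<in> carrier_mat n n"
    and "0\<^sub>m n n \<le> M"
    and "PB_Frobenius_form M"
    and "\<forall>i<n. \<forall>k\<ge>1. (M ^\<^sub>m k) *\<^sub>v unit_vec n i \<noteq> unit_vec n i \<and>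
                     (M ^\<^sub>m k) *\<^sub>v unit_vec n i \<noteq> 0\<^sub>v n"
    and "v \<in> carrier_vec n"
    and "0\<^sub>v n \<le> v"
    and "v \<noteq> 0\<^sub>v n"
  shows "\<exists>v_inf.
    l1_tendsto n
      (\<lambda>t. (1 / l1_norm ((map_mat real_of_int M ^\<^sub>m t) *\<^sub>v v)) \<cdot>\<^sub>v
             ((map_mat real_of_int M ^\<^sub>m t) *\<^sub>v v)) v_inf \<and>
    v_inf \<noteq> 0\<^sub>v n \<and>
    (\<exists>\<mu>. eigenvector (map_mat real_of_int M) v_inf \<mu>)"
proof -
  note M = assms(1) and v = assms(5)
  obtain L B where "block_triangular n L B (\<lambda>i j. M $$ (i, j))"
    using PB_Frobenius_block_triangular[OF assms(1-3)] .
  then interpret block_triangular n L B "\<lambda>i j. M $$ (i, j)" .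
  let ?A = "map_mat real_of_int M"
  have A: "?A \<in> carrier_mat n n" using M by simp
  have Mpow: "M ^\<^sub>m k \<in> carrier_mat n n" and Apow: "?A ^\<^sub>m k \<in> carrier_mat n n" for k
    using M A by (simp_all add: pow_carrier_mat)
  have nonzero: "\<exists>i<n. M $$ (i, j) \<noteq> 0" if j: "j < n" for j
  proof (rule ccontr)
    assume "\<not> (\<exists>i<n. M $$ (i, j) \<noteq> 0)"
    hence "M ^\<^sub>m 1 *\<^sub>v unit_vec n j = 0\<^sub>v n"
      using mult_unit_vec_index[OF M _ j] M by (intro eq_vecI) auto
    thus False using assms(4) j by blast
  qed
  have aperiodic: "\<exists>i<n. mpow {..<n} (\<lambda>i j. M $$ (i, j)) k i j \<noteq> (if i = j then 1 else 0)"
    if j: "j < n" and k: "1 \<le> k" for j k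
  proof (rule ccontr)
    assume "\<not> ?thesis"
    hence "M ^\<^sub>m k *\<^sub>v unit_vec n j = unit_vec n j"
      using mult_unit_vec_index[OF Mpow _ j] Mpow[of k] j
      by (intro eq_vecI) (auto simp: pow_mat_index_mpow[OF M])
    thus False using assms(4) j k by blast
  qed
  define x where "x t i = (\<Sum>j<n. mpow {..<n} A t i j * v $ j)" for t i
  have x_mat: "((?A ^\<^sub>m t) *\<^sub>v v) $ i = x t i" if i: "i < n" for t i
  proof -
    have "mpow {..<n} (\<lambda>i j. ?A $$ (i, j)) t i j = mpow {..<n} A t i j" for j
      using i M by (intro mpow_cong) auto
    thus ?thesis
      unfolding mult_mat_vec_index_sum[OF Apow v i] x_def using i
      by (intro sum.cong) (simp_all add: pow_mat_index_mpow[OF A])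
  qed
  have x_Suc: "x (Suc t) i = (\<Sum>j<n. A i j * x t j)" for t i
    unfolding x_def mpow_Suc sum_distrib_left sum_distrib_right
    by (subst sum.swap) (simp add: mult.assoc)
  have x_0: "x 0 i = v $ i" if i: "i < n" for i
    using x_mat[OF i, of 0] M v by simp
  have v_nonneg: "0 \<le> v $ i" if "i < n" for i
    using assms(6) v that by (auto simp: less_eq_vec_def)
  have v_pos: "\<exists>i<n. 0 < v $ i"
  proof (rule ccontr)
    assume "\<not> ?thesis"
    hence "v $ i = 0" if "i < n" for i
      using that v_nonneg[OF that] by force
    hence "v = 0\<^sub>v n" using v by (intro eq_vecI) auto
    thus False using assms(7) by simp
  qed
  have x0_nonneg: "0 \<le> x 0 i" if "i < n" for i
    using x_0 v_nonneg that by simp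
  have x0_pos: "\<exists>i<n. 0 < x 0 i"
    using x_0 v_pos by auto
  obtain w r where w: "\<forall>i<n. (\<lambda>t. x t i / (\<Sum>j<n. x t j)) \<longlonglongrightarrow> w i"
    "(\<Sum>i<n. w i) = 1" "\<forall>i<n. (\<Sum>j<n. A i j * w j) = r * w i"
    using limit_direction[OF nonzero aperiodic x_Suc x0_nonneg x0_pos] by blast
  define u where "u = vec n w"
  have u: "u \<in> carrier_vec n" by (simp add: u_def)
  have norm: "l1_norm ((?A ^\<^sub>m t) *\<^sub>v v) = (\<Sum>j<n. x t j)" for t
    unfolding l1_norm_def using Apow[of t] orbit_nonneg[OF x_Suc x0_nonneg]
    by (auto simp: x_mat simp del: index_mult_mat_vec intro!: sum.cong)
  have "l1_tendsto n (\<lambda>t. (1 / l1_norm ((?A ^\<^sub>m t) *\<^sub>v v)) \<cdot>\<^sub>v ((?A ^\<^sub>m t) *\<^sub>v v)) u"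
    unfolding l1_tendsto_def norm
  proof (intro conjI allI)
    show "(1 / (\<Sum>j<n. x t j)) \<cdot>\<^sub>v ((?A ^\<^sub>m t) *\<^sub>v v) \<in> carrier_vec n" for t
      using Apow[of t] v by simp
    have "(\<lambda>t. \<Sum>i<n. \<bar>x t i / (\<Sum>j<n. x t j) - w i\<bar>) \<longlonglongrightarrow> (\<Sum>i<n. 0)"
      using w(1) by (intro tendsto_sum tendsto_rabs_zero LIM_zero) auto
    moreover have "l1_norm ((1 / (\<Sum>j<n. x t j)) \<cdot>\<^sub>v ((?A ^\<^sub>m t) *\<^sub>v v) - u)
        = (\<Sum>i<n. \<bar>x t i / (\<Sum>j<n. x t j) - w i\<bar>)" for t
      unfolding l1_norm_def using Apow[of t]
      by (auto simp: u_def x_mat simp del: index_mult_mat_vec intro!: sum.cong)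
    ultimately show "(\<lambda>t. l1_norm ((1 / (\<Sum>j<n. x t j)) \<cdot>\<^sub>v ((?A ^\<^sub>m t) *\<^sub>v v) - u)) \<longlonglongrightarrow> 0"
      by simp
  qed (rule u)
  moreover have u0: "u \<noteq> 0\<^sub>v n"
  proof
    assume "u = 0\<^sub>v n"
    hence "w i = 0" if "i < n" for i
      using that by (metis u_def index_vec index_zero_vec(1))
    thus False using w(2) by simp
  qed
  moreover have "eigenvector ?A u r"
    unfolding eigenvector_def
  proof (intro conjI)
    show "u \<in> carrier_vec (dim_row ?A)" "u \<noteq> 0\<^sub>v (dim_row ?A)" using u u0 M by auto
    show "?A *\<^sub>v u = r \<cdot>\<^sub>v u"
    proof (rule eq_vecI)
      fix i assume "i < dim_vec (r \<cdot>\<^sub>v u)"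
      hence i: "i < n" by (simp add: u_def)
      have "(?A *\<^sub>v u) $ i = (\<Sum>j<n. A i j * w j)"
        unfolding mult_mat_vec_index_sum[OF A u i] using i M by (intro sum.cong) (auto simp: u_def)
      thus "(?A *\<^sub>v u) $ i = (r \<cdot>\<^sub>v u) $ i" using w(3) i by (simp add: u_def)
    qed (use M u in auto)
  qed
  ultimately show ?thesis by blast
qed

end
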